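(* Let $K$ be an algebraically closed field complete with respect to a non-trivial non-archimedean absolute value $|\cdot|$, with residue characteristic $p\geq 0$. Let $\varphi\in K(z)$ be a rational function of degree $d\geq 2$, with $\operatorname{char}K=0$ or $\operatorname{char}K>d$, and suppose that either $p=0$ or $d<p$. If $\gamma\in\mathbb{P}^1(K)$ is a periodic point of $\varphi$ of period $n$ with $0<|(\varphi^n)'(\gamma)|<1$, then there is a critical point of $\varphi$ that is strictly attracted to the cycle containing $\gamma$.
   Context: $(\varphi^n)'(\gamma)$ is the multiplier of the $n$-periodic point $\gamma$ ($n$ its minimal period), computed in a coordinate where $\gamma\neq\infty$. A point $x$ is attracted to the cycle of $\gamma$ if $\lim_{m\to\infty}\varphi^{nm}(x)=\varphi^k(\gamma)$ for some $0\leq k\leq n-1$, and strictly attracted if moreover $\varphi^l(x)\neq\gamma$ for all $l\geq 1$. *)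

theory Defs
  imports
    "HOL-Analysis.Analysis"
    "HOL-Algebra.QuotRing"
    "HOL-Computational_Algebra.Computational_Algebra"
begin

section \<open>Non-archimedean absolute values\<close>

locale nonarch_absolute_value =
  fixes av :: "'a::field \<Rightarrow> real"
  assumes nonneg: "0 \<le> av x"
    and eq_0_iff: "av x = 0 \<longleftrightarrow> x = 0"
    and mult: "av (x * y) = av x * av y"
    and ultrametric: "av (x + y) \<le> max (av x) (av y)"

definition nontrivial_av :: "('a::field \<Rightarrow> real) \<Rightarrow> bool" where
  "nontrivial_av av \<longleftrightarrow> (\<exists>x. x \<noteq> 0 \<and> av x \<noteq> 1)"

definition complete_av :: "('a::field \<Rightarrow> real) \<Rightarrow> bool" where
  "complete_av av \<longleftrightarrow> Metric_space.mcomplete UNIV (\<lambda>x y. av (x - y))"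

lemma (in nonarch_absolute_value) Metric_space_av:
  "Metric_space UNIV (\<lambda>x y. av (x - y))"
proof -
  have "av 1 = 1"
    using mult[of 1 1] eq_0_iff[of 1] by simp
  hence "av (-1) = 1"
    using mult[of "-1" "-1"] nonneg[of "-1"] by (simp add: square_eq_1_iff)
  hence comm: "av (x - y) = av (y - x)" for x y
    by (metis minus_diff_eq mult mult_1 mult_minus1)
  have tri: "av (x - z) \<le> av (x - y) + av (y - z)" for x y z
    using ultrametric[of "x - y" "y - z"] nonneg[of "x - y"] nonneg[of "y - z"]
    by (simp add: max_def split: if_splits)
  show ?thesis
    by unfold_locales (fact nonneg comm tri | simp add: eq_0_iff)+
qed

definition valuation_ring :: "('a::field \<Rightarrow> real) \<Rightarrow> 'a ring" where
  "valuation_ring av =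
     \<lparr>carrier = {x. av x \<le> 1}, monoid.mult = (*), one = 1, zero = 0, add = (+)\<rparr>"

definition residue_field :: "('a::field \<Rightarrow> real) \<Rightarrow> 'a set ring" where
  "residue_field av = valuation_ring av Quot {x. av x < 1}"

definition ring_characteristic :: "('r, 'm) ring_scheme \<Rightarrow> nat" where
  "ring_characteristic R = Gcd {n::nat. [n] \<cdot>\<^bsub>R\<^esub> \<one>\<^bsub>R\<^esub> = \<zero>\<^bsub>R\<^esub>}"

definition residue_char :: "('a::field \<Rightarrow> real) \<Rightarrow> nat" where
  "residue_char av = ring_characteristic (residue_field av)"

section \<open>Rational functions\<close>

text \<open>The field \<open>K(z)\<close> is \<open>'a poly fract\<close>. Numerator and denominator in lowest terms are
  determined up to a common nonzero constant, on which nothing below depends.\<close>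

definition lowest_terms :: "'a::field poly fract \<Rightarrow> 'a poly \<times> 'a poly \<Rightarrow> bool" where
  "lowest_terms \<phi> = (\<lambda>(P, Q). Q \<noteq> 0 \<and> Rings.coprime P Q \<and> \<phi> = Fraction_Field.Fract P Q)"

definition rat_quot :: "'a::field poly fract \<Rightarrow> 'a poly \<times> 'a poly" where
  "rat_quot \<phi> = (SOME PQ. lowest_terms \<phi> PQ)"

lemma lowest_terms_rat_quot: "lowest_terms \<phi> (rat_quot \<phi>)"
proof -
  obtain a b where ab: "\<phi> = Fraction_Field.Fract a b" "b \<noteq> 0"
    by (rule Fract_cases)
  define R where "R = (\<lambda>PQ. snd PQ \<noteq> 0 \<and> \<phi> = Fraction_Field.Fract (fst PQ) (snd PQ))"
  have "R (a, b)" unfolding R_def using ab by simp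
  then obtain PQ where PQ: "R PQ" and
    least: "\<And>PQ'. R PQ' \<Longrightarrow> degree (snd PQ) \<le> degree (snd PQ')"
    using ex_has_least_nat[of R "(a, b)" "\<lambda>PQ. degree (snd PQ)"] by metis
  define P where "P = fst PQ"
  define Q where "Q = snd PQ"
  have Q: "Q \<noteq> 0" "\<phi> = Fraction_Field.Fract P Q"
    using PQ unfolding P_def Q_def R_def by blast+
  have "Rings.coprime P Q"
  proof (rule Rings.coprimeI)
    fix c assume "c dvd P" "c dvd Q"
    then obtain P' Q' where c: "P = c * P'" "Q = c * Q'" unfolding dvd_def by blast
    have nz: "c \<noteq> 0" "Q' \<noteq> 0" using Q(1) c(2) by auto
    have "Fraction_Field.Fract P Q = Fraction_Field.Fract P' Q'"
      unfolding c using nz by (simp add: eq_fract)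
    hence "R (P', Q')" using Q(2) nz(2) by (simp add: R_def)
    from least[OF this] have "degree Q \<le> degree Q'" by (simp add: Q_def)
    hence "degree c = 0" using nz by (simp add: c(2) degree_mult_eq)
    thus "is_unit c" using nz(1) by (simp add: is_unit_iff_degree)
  qed
  hence "lowest_terms \<phi> (P, Q)" using Q by (simp add: lowest_terms_def)
  thus ?thesis
    unfolding rat_quot_def by (rule someI)
qed

definition rat_degree :: "'a::field poly fract \<Rightarrow> nat" where
  "rat_degree \<phi> = (case rat_quot \<phi> of (P, Q) \<Rightarrow> max (degree P) (degree Q))"

definition rat_var :: "'a::field poly fract" where
  "rat_var = to_fract [:0, 1:]"

text \<open>Substitution \<open>P(\<psi>) / Q(\<psi>)\<close> in \<open>K(z)\<close>. For nonconstant \<open>\<psi>\<close> the denominator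
  \<open>Q(\<psi>)\<close> is never zero; only nonconstant \<open>\<psi>\<close> matter below.\<close>

definition rat_comp :: "'a::field poly fract \<Rightarrow> 'a poly fract \<Rightarrow> 'a poly fract" where
  "rat_comp \<phi> \<psi> = (case rat_quot \<phi> of (P, Q) \<Rightarrow>
     poly (map_poly (\<lambda>c. to_fract [:c:]) P) \<psi> / poly (map_poly (\<lambda>c. to_fract [:c:]) Q) \<psi>)"

definition rat_iter :: "'a::field poly fract \<Rightarrow> nat \<Rightarrow> 'a poly fract" where
  "rat_iter \<phi> n = (rat_comp \<phi> ^^ n) rat_var"

section \<open>The projective line\<close>

datatype 'a proj_line = Fin 'a | Infty

text \<open>At \<open>\<infinity>\<close> the value is the ratio of the coefficients of degree \<open>rat_degree \<phi>\<close>.\<close>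

fun rat_eval :: "'a::field poly fract \<Rightarrow> 'a proj_line \<Rightarrow> 'a proj_line" where
  "rat_eval \<phi> (Fin a) = (case rat_quot \<phi> of (P, Q) \<Rightarrow>
     if poly Q a = 0 then Infty else Fin (poly P a / poly Q a))"
| "rat_eval \<phi> Infty = (case rat_quot \<phi> of (P, Q) \<Rightarrow>
     if degree Q < degree P then Infty else Fin (coeff P (degree Q) / coeff Q (degree Q)))"

text \<open>The chordal metric, which induces the usual topology on \<open>P\<^sup>1(K)\<close>.\<close>

fun chordal :: "('a::field \<Rightarrow> real) \<Rightarrow> 'a proj_line \<Rightarrow> 'a proj_line \<Rightarrow> real" where
  "chordal av (Fin x) (Fin y) = av (x - y) / (max 1 (av x) * max 1 (av y))"
| "chordal av (Fin x) Infty = 1 / max 1 (av x)"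
| "chordal av Infty (Fin y) = 1 / max 1 (av y)"
| "chordal av Infty Infty = 0"

definition proj_tendsto ::
    "('a::field \<Rightarrow> real) \<Rightarrow> (nat \<Rightarrow> 'a proj_line) \<Rightarrow> 'a proj_line \<Rightarrow> bool" where
  "proj_tendsto av X y \<longleftrightarrow> (\<lambda>m. chordal av (X m) y) \<longlonglongrightarrow> 0"

section \<open>Derivatives, multipliers and critical points\<close>

text \<open>The quotient rule for \<open>\<phi> = P / Q\<close>, evaluated at a point \<open>a\<close> of \<open>K\<close> that is not a pole.\<close>

definition rat_deriv_at :: "'a::field poly fract \<Rightarrow> 'a \<Rightarrow> 'a" where
  "rat_deriv_at \<phi> a = (case rat_quot \<phi> of (P, Q) \<Rightarrow>
     (poly (pderiv P) a * poly Q a - poly P a * poly (pderiv Q) a) / (poly Q a)\<^sup>2)"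

text \<open>The derivative of \<open>\<phi>\<close> at \<open>x\<close> with respect to the coordinate \<open>z\<close> at finite points and
  \<open>1 / z\<close> at \<open>\<infinity>\<close>, both at \<open>x\<close> and at \<open>\<phi>(x)\<close>. At a fixed point the two
  coordinates agree, so this is the derivative of the conjugate of \<open>\<phi>\<close> by the coordinate change.\<close>

definition local_deriv :: "'a::field poly fract \<Rightarrow> 'a proj_line \<Rightarrow> 'a" where
  "local_deriv \<phi> x =
     (let \<psi> = (case x of Fin a \<Rightarrow> \<phi> | Infty \<Rightarrow> rat_comp \<phi> (inverse rat_var));
          \<theta> = (case rat_eval \<phi> x of Fin b \<Rightarrow> \<psi> | Infty \<Rightarrow> inverse \<psi>)
      in rat_deriv_at \<theta> (case x of Fin a \<Rightarrow> a | Infty \<Rightarrow> 0))"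

definition multiplier :: "'a::field poly fract \<Rightarrow> nat \<Rightarrow> 'a proj_line \<Rightarrow> 'a" where
  "multiplier \<phi> n \<gamma> = local_deriv (rat_iter \<phi> n) \<gamma>"

definition critical_point :: "'a::field poly fract \<Rightarrow> 'a proj_line \<Rightarrow> bool" where
  "critical_point \<phi> x \<longleftrightarrow> local_deriv \<phi> x = 0"

section \<open>Periodic points and attraction\<close>

definition periodic_point :: "'a::field poly fract \<Rightarrow> nat \<Rightarrow> 'a proj_line \<Rightarrow> bool" where
  "periodic_point \<phi> n \<gamma> \<longleftrightarrow> 0 < n \<and> (rat_eval \<phi> ^^ n) \<gamma> = \<gamma> \<and>
     (\<forall>m. 0 < m \<and> m < n \<longrightarrow> (rat_eval \<phi> ^^ m) \<gamma> \<noteq> \<gamma>)"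

definition attracted_to_cycle ::
    "('a::field \<Rightarrow> real) \<Rightarrow> 'a poly fract \<Rightarrow> nat \<Rightarrow> 'a proj_line \<Rightarrow> 'a proj_line \<Rightarrow> bool" where
  "attracted_to_cycle av \<phi> n \<gamma> x \<longleftrightarrow>
     (\<exists>k<n. proj_tendsto av (\<lambda>m. (rat_eval \<phi> ^^ (n * m)) x) ((rat_eval \<phi> ^^ k) \<gamma>))"

definition strictly_attracted_to_cycle ::
    "('a::field \<Rightarrow> real) \<Rightarrow> 'a poly fract \<Rightarrow> nat \<Rightarrow> 'a proj_line \<Rightarrow> 'a proj_line \<Rightarrow> bool" where
  "strictly_attracted_to_cycle av \<phi> n \<gamma> x \<longleftrightarrow>
     attracted_to_cycle av \<phi> n \<gamma> x \<and> (\<forall>l\<ge>1. (rat_eval \<phi> ^^ l) x \<noteq> \<gamma>)"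

end

theory Submission
  imports Defs
begin

text \<open>In coordinates centred at the points of the cycle, \<open>\<phi>\<close> becomes a sequence of rational functions
  \<open>f = P / Q\<close> with \<open>f 0 = 0\<close> and \<open>f \<infinity> = 0\<close>. Since all integers up to \<open>d\<close> are units, the
  logarithmic derivative of \<open>f\<close> on a generic circle is read off from the numbers of zeros and poles
  inside; this is a Riemann--Hurwitz formula for discs with holes. It shows that, unless some critical
  point \<open>c\<close> has \<open>0 < |f c| < s\<close>, the whole disc \<open>|z| < s / |f'(0)|\<close> is dilated by \<open>f\<close> with factor
  \<open>|f'(0)|\<close>. Starting from a small disc in the basin and pulling back along the cycle, one either
  meets a critical point that is strictly attracted, or enlarges the disc by \<open>1 / |\<lambda>| > 1\<close> in each
  turn. In the second case all points other than \<open>0\<close> and \<open>\<infinity>\<close> would lie in the strict basin, which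
  is impossible: a preimage of \<open>\<infinity>\<close> is mapped to the cycle.\<close>

section \<open>Roots of polynomials over an algebraically closed field\<close>

text \<open>The cycle is followed one step at a time because tameness concerns degree
  \<open>d\<close> only: the \<open>n\<close>-th iterate has degree \<open>d ^ n\<close>, and
  integers up to that bound need not be units. The price is a separate coordinate at each point of
  the cycle, with scale factors that telescope over one turn. The main obstacle is that a component
  of the preimage of a disc need not be a disc. Poles cut holes into it, so the counts on the holes
  have to be subtracted from the count on the outer disc. Generic absolute values on circles,
  monomials in the radius between roots, reduce this to bookkeeping with multisets of roots.
  Critical points that are zeros of \<open>f\<close> land on the cycle and are useless for strict
  attraction. They cancel from the count, since in the tame case a zero of order \<open>k\<close> is
  a zero of order \<open>k - 1\<close> of the Wronskian. Lifting to homogeneous vectors treats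
  infinity like any other point and makes the multiplier a product of values of one form along the
  orbit.\<close>

definition wronskian :: "'a::idom poly \<Rightarrow> 'a poly \<Rightarrow> 'a poly" where
  "wronskian A B = pderiv A * B - A * pderiv B"

lemma poly_pderiv_prod_mset:
  fixes z :: "'a::field"
  assumes "z \<notin># M"
  shows "poly (pderiv (\<Prod>x\<in>#M. [:-x, 1:])) z = poly (\<Prod>x\<in>#M. [:-x, 1:]) z * (\<Sum>x\<in>#M. 1 / (z - x))"
  using assms
proof (induction M)
  case (add x M)
  hence "z \<noteq> x" by auto
  with add show ?case
    by (simp add: pderiv_mult pderiv_pCons field_simps del: mult_pCons_left)
qed simp

lemma proots_prod_mset_linear: "proots (\<Prod>x\<in>#M. [:-x, 1:]) = (M :: 'a::field multiset)"
proof (induction M)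
  case (add x M)
  have "(\<Prod>x\<in>#M. [:-x, 1:]) \<noteq> 0" by auto
  thus ?case using add by (simp add: proots_mult del: mult_pCons_left)
qed simp

lemma poly_splits_proots:
  fixes p :: "'a::alg_closed_field poly"
  shows "p = smult (lead_coeff p) (\<Prod>x\<in>#proots p. [:-x, 1:])"
proof (cases "p = 0")
  case False
  obtain A where A: "p = smult (lead_coeff p) (\<Prod>x\<in>#A. [:-x, 1:])"
    using alg_closed_imp_factorization[OF False] by metis
  have "proots p = A"
    using arg_cong[OF A, of proots] False by (simp add: proots_prod_mset_linear)
  thus ?thesis using A by simp
qed simp

lemma poly_eq_prod_proots:
  fixes p :: "'a::alg_closed_field poly"
  shows "poly p z = lead_coeff p * (\<Prod>x\<in>#proots p. z - x)"
proof -
  have "poly (\<Prod>x\<in>#M. [:-x, 1:]) z = (\<Prod>x\<in>#M. z - x)" for M :: "'a multiset"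
    by (induction M) (auto simp: algebra_simps)
  with arg_cong[OF poly_splits_proots[of p], of "\<lambda>q. poly q z"] show ?thesis by simp
qed

lemma poly_pderiv_proots:
  fixes p :: "'a::alg_closed_field poly"
  assumes "poly p z \<noteq> 0"
  shows "poly (pderiv p) z = poly p z * (\<Sum>x\<in>#proots p. 1 / (z - x))"
proof -
  have "z \<notin># proots p" using assms by (cases "p = 0") auto
  from poly_pderiv_prod_mset[OF this] arg_cong[OF poly_splits_proots[of p], of "\<lambda>q. poly q z"]
    arg_cong[OF poly_splits_proots[of p], of "\<lambda>q. poly (pderiv q) z"]
  show ?thesis by (simp add: pderiv_smult)
qed

lemma size_proots_alg_closed:
  fixes p :: "'a::alg_closed_field poly"
  assumes "p \<noteq> 0"
  shows "size (proots p) = degree p"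
proof -
  obtain A where A: "size A = degree p" "p = smult (lead_coeff p) (\<Prod>x\<in>#A. [:-x, 1:])"
    using alg_closed_imp_factorization[OF assms] by metis
  have "proots p = A"
    using arg_cong[OF A(2), of proots] assms by (simp add: proots_prod_mset_linear)
  thus ?thesis using A by simp
qed

section \<open>Gauss norms and root counts\<close>

context nonarch_absolute_value
begin

lemma av_0 [simp]: "av 0 = 0"
  by (simp add: eq_0_iff)

lemma av_pos_iff: "0 < av x \<longleftrightarrow> x \<noteq> 0"
  using nonneg[of x] eq_0_iff[of x] by linarith

lemma av_1 [simp]: "av 1 = 1"
  using mult[of 1 1] eq_0_iff[of 1] by simp

lemma av_minus [simp]: "av (- x) = av x"
proof -
  have "av (-1) = 1"
    using mult[of "-1" "-1"] nonneg[of "-1"] by (simp add: square_eq_1_iff)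
  thus ?thesis using mult[of "-1" x] by simp
qed

lemma av_diff_commute: "av (x - y) = av (y - x)"
  using av_minus[of "x - y"] by simp

lemma ultrametric_diff: "av (x - y) \<le> max (av x) (av y)"
  using ultrametric[of x "- y"] by simp

lemma ultrametric_less: "av x < r \<Longrightarrow> av y < r \<Longrightarrow> av (x + y) < r"
  using ultrametric[of x y] by simp

lemma ultrametric_diff_less: "av x < r \<Longrightarrow> av y < r \<Longrightarrow> av (x - y) < r"
  using ultrametric_diff[of x y] by simp

lemma av_add_eq: "av y < av x \<Longrightarrow> av (x + y) = av x"
  using ultrametric[of x y] ultrametric_diff[of "x + y" y] by (simp add: max_def split: if_splits)

lemma av_power: "av (x ^ k) = av x ^ k"
  by (induction k) (simp_all add: mult)

lemma av_inverse: "av (inverse x) = inverse (av x)"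
proof (cases "x = 0")
  case False
  hence "av x * av (inverse x) = 1" using mult[of x "inverse x"] by simp
  thus ?thesis by (metis inverse_unique)
qed simp

lemma av_divide: "av (x / y) = av x / av y"
  by (simp add: divide_inverse mult av_inverse)

lemma av_prod_mset: "av (\<Prod>x\<in>#M. f x) = (\<Prod>x\<in>#M. av (f x))"
  by (induction M) (simp_all add: mult)

lemma av_of_nat_le: "av (of_nat m) \<le> 1"
proof (induction m)
  case (Suc m)
  thus ?case using ultrametric[of 1 "of_nat m"] by simp
qed simp

text \<open>For a split polynomial this is the generic absolute value on the circle of radius
  \<open>r\<close> about \<open>a\<close>. The product over roots makes continuity and the piecewise
  monomial shape in \<open>r\<close> visible.\<close>

definition gauss_norm :: "'a poly \<Rightarrow> 'a \<Rightarrow> real \<Rightarrow> real" where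
  "gauss_norm p a r = av (lead_coeff p) * (\<Prod>\<alpha>\<in>#proots p. max r (av (a - \<alpha>)))"

definition root_count :: "'a poly \<Rightarrow> 'a set \<Rightarrow> nat" where
  "root_count p S = size (filter_mset (\<lambda>\<alpha>. \<alpha> \<in> S) (proots p))"

lemma max_av_cong: "av (a - b) \<le> r \<Longrightarrow> max r (av (a - c)) = max r (av (b - c))"
  using ultrametric[of "a - b" "b - c"] ultrametric_diff[of "a - c" "a - b"]
  by (auto simp: max_def split: if_splits)

text \<open>Every point of a closed ultrametric disc is a centre. This allows radii found around
  different poles to be compared.\<close>

lemma gauss_norm_cong: "av (a - b) \<le> r \<Longrightarrow> gauss_norm p a r = gauss_norm p b r"
  unfolding gauss_norm_def using max_av_cong[of a b r] by simp

lemma continuous_on_gauss_norm: "continuous_on S (gauss_norm p a)"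
proof -
  have "continuous_on S (\<lambda>r. \<Prod>\<alpha>\<in>#M. max r (av (a - \<alpha>)))" for M
    by (induction M) (auto intro!: continuous_intros)
  thus ?thesis unfolding gauss_norm_def by (intro continuous_intros)
qed

text \<open>Roots within \<open>r1\<close> contribute a factor \<open>r\<close>, all others a
  constant. Both end radii are included, so values at the ends of an annulus can be
  compared.\<close>

lemma gauss_norm_monomial:
  assumes "p \<noteq> 0" "0 \<le> r1" "r1 < r2"
    and gap: "\<And>\<alpha>. poly p \<alpha> = 0 \<Longrightarrow> \<not> (r1 < av (a - \<alpha>) \<and> av (a - \<alpha>) < r2)"
  shows "\<exists>K>0. \<forall>r. r1 \<le> r \<and> r \<le> r2 \<longrightarrow>
           gauss_norm p a r = K * r ^ root_count p {\<alpha>. av (a - \<alpha>) \<le> r1}"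
proof -
  have "\<exists>K>0. \<forall>r. r1 \<le> r \<and> r \<le> r2 \<longrightarrow> (\<Prod>\<alpha>\<in>#M. max r (av (a - \<alpha>))) =
          K * r ^ size (filter_mset (\<lambda>\<alpha>. av (a - \<alpha>) \<le> r1) M)"
    if "\<And>\<alpha>. \<alpha> \<in># M \<Longrightarrow> \<not> (r1 < av (a - \<alpha>) \<and> av (a - \<alpha>) < r2)" for M
    using that
  proof (induction M)
    case empty
    show ?case by (rule exI[of _ 1]) simp
  next
    case (add x M)
    then obtain K where K: "K > 0" "\<forall>r. r1 \<le> r \<and> r \<le> r2 \<longrightarrow> (\<Prod>\<alpha>\<in>#M. max r (av (a - \<alpha>))) =
          K * r ^ size (filter_mset (\<lambda>\<alpha>. av (a - \<alpha>) \<le> r1) M)" by auto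
    show ?case
    proof (cases "av (a - x) \<le> r1")
      case True
      show ?thesis
        by (rule exI[of _ K]) (use True K in \<open>auto simp: max_def\<close>)
    next
      case False
      with add.prems[of x] have "r2 \<le> av (a - x)" by auto
      thus ?thesis
        by (intro exI[of _ "K * av (a - x)"]) (use False K assms in \<open>auto simp: max_def\<close>)
    qed
  qed
  from this[of "proots p"] assms(1) gap obtain K where K: "K > 0"
    "\<forall>r. r1 \<le> r \<and> r \<le> r2 \<longrightarrow> (\<Prod>\<alpha>\<in>#proots p. max r (av (a - \<alpha>))) =
          K * r ^ size (filter_mset (\<lambda>\<alpha>. av (a - \<alpha>) \<le> r1) (proots p))" by auto
  have "av (lead_coeff p) > 0" using assms(1) by (simp add: av_pos_iff)
  with K show ?thesis
    by (intro exI[of _ "av (lead_coeff p) * K"]) (simp add: gauss_norm_def root_count_def)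
qed

text \<open>Each summand is congruent to 1 modulo the maximal ideal if its root is closer to
  \<open>a\<close> than \<open>z\<close> is, and to 0 if it is farther away.\<close>

lemma log_derivative_approx:
  assumes "\<And>\<alpha>. \<alpha> \<in># M \<Longrightarrow> av (a - \<alpha>) \<noteq> av (z - a)"
  shows "av ((\<Sum>\<alpha>\<in>#M. (z - a) / (z - \<alpha>)) -
             of_nat (size (filter_mset (\<lambda>\<alpha>. av (a - \<alpha>) < av (z - a)) M))) < 1"
  using assms
proof (induction M)
  case (add x M)
  let ?S = "\<Sum>\<alpha>\<in>#M. (z - a) / (z - \<alpha>)"
    and ?k = "of_nat (size (filter_mset (\<lambda>\<alpha>. av (a - \<alpha>) < av (z - a)) M))"
  have IH: "av (?S - ?k) < 1" using add by simp
  have zx: "z - x = (z - a) + (a - x)" by simp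
  show ?case
  proof (cases "av (a - x) < av (z - a)")
    case True
    have e: "av (z - x) = av (z - a)" unfolding zx by (rule av_add_eq[OF True])
    have nz: "z - x \<noteq> 0" using e True nonneg[of "a - x"] eq_0_iff by force
    hence "(z - a) / (z - x) - 1 = (x - a) / (z - x)" by (simp add: field_simps)
    moreover have "av ((x - a) / (z - x)) < 1"
      using True e nonneg[of "a - x"] by (simp add: av_divide av_diff_commute[of x a])
    ultimately have "av (((z - a) / (z - x) - 1) + (?S - ?k)) < 1"
      using IH by (intro ultrametric_less) simp_all
    thus ?thesis using True by (simp add: algebra_simps)
  next
    case False
    with add.prems[of x] have lt: "av (z - a) < av (a - x)" by force
    have e: "av (z - x) = av (a - x)"
      unfolding zx add.commute[of "z - a"] by (rule av_add_eq[OF lt])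
    have "av ((z - a) / (z - x)) < 1"
      using lt e nonneg[of "z - a"] by (simp add: av_divide)
    hence "av ((z - a) / (z - x) + (?S - ?k)) < 1"
      using IH by (intro ultrametric_less) simp_all
    thus ?thesis using False by (simp add: algebra_simps)
  qed
qed simp

lemma exists_gap:
  assumes "finite S" "(r::real) < r'"
  shows "\<exists>r2. r < r2 \<and> r2 < r' \<and> (\<forall>x\<in>S. \<not> (r < x \<and> x \<le> r2))"
proof -
  let ?T = "insert r' {x\<in>S. r < x}"
  have fin: "finite ?T" using assms(1) by simp
  have m: "r < Min ?T" using assms fin by (subst Min_gr_iff) auto
  then obtain r2 where "r < r2" "r2 < Min ?T" using dense by blast
  moreover have "Min ?T \<le> x" if "x \<in> ?T" for x using fin that by (rule Min_le)
  ultimately show ?thesis by (intro exI[of _ r2]) fastforce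
qed

lemma root_count_altdef:
  assumes "p \<noteq> 0"
  shows "root_count p S = (\<Sum>\<alpha> | \<alpha> \<in> S \<and> poly p \<alpha> = 0. Polynomial.order \<alpha> p)"
proof -
  have eq: "set_mset (filter_mset (\<lambda>\<alpha>. \<alpha> \<in> S) (proots p)) = {\<alpha>. \<alpha> \<in> S \<and> poly p \<alpha> = 0}"
    using assms by auto
  show ?thesis
    unfolding root_count_def size_multiset_overloaded_eq eq
    by (rule sum.cong) (use assms in auto)
qed

lemma root_count_cong:
  assumes "\<And>\<alpha>. poly p \<alpha> = 0 \<Longrightarrow> \<alpha> \<in> A \<longleftrightarrow> \<alpha> \<in> B"
  shows "root_count p A = root_count p B"
proof (cases "p = 0")
  case False
  thus ?thesis
    unfolding root_count_def using assms
    by (intro arg_cong[where f = size] filter_mset_cong) auto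
qed (simp add: root_count_def)

lemma root_count_Un:
  assumes "A \<inter> B = {}"
  shows "root_count p (A \<union> B) = root_count p A + root_count p B"
proof -
  have "size (filter_mset (\<lambda>\<alpha>. \<alpha> \<in> A \<union> B) M) =
        size (filter_mset (\<lambda>\<alpha>. \<alpha> \<in> A) M) + size (filter_mset (\<lambda>\<alpha>. \<alpha> \<in> B) M)" for M
    using assms by (induction M) auto
  thus ?thesis by (simp add: root_count_def)
qed

lemma root_count_Union_disjoint:
  assumes "finite F" "pairwise disjnt F"
  shows "root_count p (\<Union>F) = (\<Sum>A\<in>F. root_count p A)"
  using assms
proof (induction F)
  case empty
  show ?case by (simp add: root_count_def)
next
  case (insert A F)
  have "A \<inter> \<Union>F = {}"
    using insert.prems insert.hyps(2) by (fastforce simp: pairwise_insert disjnt_def)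
  with insert show ?case by (simp add: root_count_Un pairwise_insert)
qed

lemma gauss_norm_mult:
  "gauss_norm (p * q) a r = gauss_norm p a r * gauss_norm q a r"
proof (cases "p = 0 \<or> q = 0")
  case False
  thus ?thesis by (simp add: gauss_norm_def proots_mult lead_coeff_mult mult)
qed (auto simp: gauss_norm_def)

end

section \<open>Residue characteristic\<close>

context nonarch_absolute_value
begin

text \<open>Elements of the quotient are cosets of the maximal ideal, that is, open unit balls;
  multiples of one are the balls around integers.\<close>

lemma residue_field_add_pow:
  "[m] \<cdot>\<^bsub>residue_field av\<^esub> \<one>\<^bsub>residue_field av\<^esub> = {x. av (x - of_nat m) < 1}" for m :: nat
proof (induction m)
  case 0
  show ?case by (simp add: add_pow_def nat_pow_def residue_field_def FactRing_def)
next
  case (Suc m)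
  have one: "\<one>\<^bsub>residue_field av\<^esub> = {x. av (x - 1) < 1}"
  proof -
    have "\<one>\<^bsub>residue_field av\<^esub> = (\<Union>h\<in>{x. av x < 1}. {h + 1})"
      by (simp add: residue_field_def FactRing_def valuation_ring_def a_r_coset_def')
    thus ?thesis by (force simp: algebra_simps)
  qed
  have "[Suc m] \<cdot>\<^bsub>residue_field av\<^esub> \<one>\<^bsub>residue_field av\<^esub> =
      [m] \<cdot>\<^bsub>residue_field av\<^esub> \<one>\<^bsub>residue_field av\<^esub> \<oplus>\<^bsub>residue_field av\<^esub> \<one>\<^bsub>residue_field av\<^esub>"
    by (simp add: add_pow_def nat_pow_def)
  also have "\<dots> = (\<Union>x\<in>{x. av (x - of_nat m) < 1}. \<Union>y\<in>{x. av (x - 1) < 1}. {x + y})"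
  proof -
    have plus: "A \<oplus>\<^bsub>residue_field av\<^esub> B = (\<Union>x\<in>A. \<Union>y\<in>B. {x + y})" for A B
      by (simp add: residue_field_def FactRing_def valuation_ring_def set_add_def')
    show ?thesis unfolding plus Suc unfolding one ..
  qed
  also have "\<dots> = {x. av (x - of_nat (Suc m)) < 1}"
  proof (intro equalityI subsetI)
    fix z assume "z \<in> (\<Union>x\<in>{x. av (x - of_nat m) < 1}. \<Union>y\<in>{x. av (x - 1) < 1}. {x + y})"
    then obtain x y where xy: "av (x - of_nat m) < 1" "av (y - 1) < 1" "z = x + y" by auto
    have "z - of_nat (Suc m) = (x - of_nat m) + (y - 1)" by (simp add: xy)
    thus "z \<in> {x. av (x - of_nat (Suc m)) < 1}"
      using ultrametric_less[OF xy(1,2)] by (simp only: mem_Collect_eq)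
  next
    fix z assume "z \<in> {x. av (x - of_nat (Suc m)) < 1}"
    hence "z - 1 \<in> {x. av (x - of_nat m) < 1}" by (simp add: algebra_simps)
    moreover have "1 \<in> {x. av (x - 1) < 1}" by simp
    ultimately show "z \<in> (\<Union>x\<in>{x. av (x - of_nat m) < 1}. \<Union>y\<in>{x. av (x - 1) < 1}. {x + y})"
      by (metis (no_types, lifting) UN_I diff_add_cancel singletonI)
  qed
  finally show ?case .
qed

text \<open>Otherwise the ball around \<open>m\<close> would be the maximal ideal, so the residue
  characteristic would divide \<open>m\<close>, which is impossible for \<open>0 < m \<le> d\<close>
  in both cases.\<close>

lemma av_of_nat_eq_1:
  assumes "residue_char av = 0 \<or> d < residue_char av" "0 < m" "m \<le> d"
  shows "av (of_nat m) = 1"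
proof (rule ccontr)
  assume "av (of_nat m) \<noteq> 1"
  hence less: "av (of_nat m) < 1" using av_of_nat_le[of m] by simp
  have "{x. av (x - of_nat m) < 1} = {x. av x < 1}"
    using ultrametric_less[OF _ less, of "x - of_nat m" for x] ultrametric_diff_less[OF _ less] by fastforce
  hence "[m] \<cdot>\<^bsub>residue_field av\<^esub> \<one>\<^bsub>residue_field av\<^esub> = \<zero>\<^bsub>residue_field av\<^esub>"
    unfolding residue_field_add_pow by (simp add: residue_field_def FactRing_def)
  hence "residue_char av dvd m"
    unfolding residue_char_def ring_characteristic_def by (intro Gcd_dvd) simp
  thus False using assms by (auto dest: dvd_imp_le)
qed

end

section \<open>Discs on which a rational function is a dilation\<close>

locale tame_av = nonarch_absolute_value av
  for av :: "'a::alg_closed_field \<Rightarrow> real" +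
  fixes d :: nat
  assumes nontrivial: "nontrivial_av av"
    and tame: "0 < m \<Longrightarrow> m \<le> d \<Longrightarrow> av (of_nat m) = 1"
begin

text \<open>A root \<open>y\<close> of high order of an element larger than 1 has absolute value
  barely above 1, so its integer powers cannot jump over the interval.\<close>

lemma exists_av_between:
  assumes "0 \<le> r1" "r1 < r2"
  shows "\<exists>z. r1 < av z \<and> av z < r2"
proof -
  obtain x0 where x0: "x0 \<noteq> 0" "av x0 \<noteq> 1" using nontrivial by (auto simp: nontrivial_av_def)
  obtain x where x: "av x > 1"
  proof (cases "av x0 > 1")
    case False
    have "0 < av x0" using x0 av_pos_iff by blast
    hence "av (inverse x0) > 1" using False x0 by (simp add: av_inverse one_less_inverse)
    thus ?thesis by (rule that)
  qed (rule that)
  define r where "r = max r1 (r2 / 2)"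
  have r: "0 < r" "r1 \<le> r" "r < r2" using assms by (auto simp: r_def)
  have "(\<lambda>n. root n (av x)) \<longlonglongrightarrow> 1" using x by (intro LIMSEQ_root_const) simp
  moreover have "r2 / r > 1" using r by simp
  ultimately have "eventually (\<lambda>n. root n (av x) < r2 / r) sequentially"
    by (rule order_tendstoD(2))
  from eventually_happens[OF eventually_conj[OF this eventually_gt_at_top[of 0]]]
  obtain n where n: "n > 0" "root n (av x) < r2 / r" by auto
  obtain y where y: "y ^ n = x" using nth_root_exists[OF n(1)] by blast
  have avy: "av y = root n (av x)"
    using real_root_power_cancel[OF n(1) nonneg[of y]] unfolding y[symmetric] av_power by simp
  have y1: "av y > 1" using avy x n(1) by simp
  \<comment> \<open>The least exponent at which the powers of \<open>av y\<close> exceed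
    \<open>r\<close>; the last step is a factor below \<open>r2 / r\<close>.\<close>
  define k where "k = \<lfloor>log (av y) r\<rfloor> + 1"
  have k: "real_of_int k - 1 \<le> log (av y) r" "log (av y) r < real_of_int k"
    unfolding k_def by linarith+
  have avk: "\<exists>z. av z = av y powr real_of_int k" for k
  proof (cases "k \<ge> 0")
    case True
    hence "av (y ^ nat k) = av y powr real_of_int k"
      using y1 by (simp add: av_power powr_realpow[symmetric])
    thus ?thesis by blast
  next
    case False
    hence "av (inverse (y ^ nat (- k))) = inverse (av y powr real_of_int (- k))"
      using y1 by (simp add: av_power av_inverse powr_realpow[symmetric])
    hence "av (inverse (y ^ nat (- k))) = av y powr real_of_int k" by (simp add: powr_minus)
    thus ?thesis by blast
  qed
  then obtain z where z: "av z = av y powr real_of_int k" by blast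
  have "r < av z" using k(2) y1 r(1) unfolding z by (simp add: log_less_iff)
  moreover have "av z < r2"
  proof -
    have "av y powr (real_of_int k - 1) \<le> r" using k(1) y1 r(1) by (simp add: le_log_iff)
    hence "av z \<le> r * av y"
      using y1 unfolding z by (simp add: powr_diff field_simps)
    also have "\<dots> < r2" using n(2) avy r by (simp add: field_simps)
    finally show ?thesis .
  qed
  ultimately show ?thesis using r by (intro exI[of _ z]) simp
qed

text \<open>If two sides of an ultrametric triangle differ in length, the third equals the longer
  one; so every factor of the product is exact.\<close>

lemma av_poly_eq_gauss_norm:
  assumes "\<And>\<alpha>. poly p \<alpha> = 0 \<Longrightarrow> av (a - \<alpha>) \<noteq> av (z - a)"
  shows "av (poly p z) = gauss_norm p a (av (z - a))"
proof (cases "p = 0")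
  case False
  have "av (z - \<alpha>) = max (av (z - a)) (av (a - \<alpha>))" if "\<alpha> \<in># proots p" for \<alpha>
    using assms[of \<alpha>] that False av_add_eq[of "a - \<alpha>" "z - a"] av_add_eq[of "z - a" "a - \<alpha>"]
    by (auto simp: max_def add.commute)
  hence "(\<Prod>\<alpha>\<in>#proots p. av (z - \<alpha>)) = (\<Prod>\<alpha>\<in>#proots p. max (av (z - a)) (av (a - \<alpha>)))"
    by (metis (mono_tags, lifting) image_mset_cong)
  thus ?thesis
    by (simp add: poly_eq_prod_proots[of p z] gauss_norm_def mult av_prod_mset)
qed (simp add: gauss_norm_def)

lemma gauss_norm_0: "gauss_norm p a 0 = av (poly p a)"
proof -
  have "max 0 (av x) = av x" for x using nonneg[of x] by simp
  thus ?thesis by (simp add: poly_eq_prod_proots[of p a] gauss_norm_def mult av_prod_mset)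
qed

text \<open>On a circle \<open>|z - a| = \<rho>\<close> carrying no roots, the logarithmic derivative
  \<open>(z - a) (P'/P - Q'/Q)\<close> is congruent to the nonzero integer \<open>Z - N\<close> modulo the maximal ideal,
  so \<open>|wronskian P Q|\<close> and \<open>|P Q| / \<rho>\<close> agree there. Comparing two radii gives the count.\<close>

lemma root_count_wronskian:
  assumes "P \<noteq> 0" "Q \<noteq> 0" "0 \<le> r1" "r1 < r2"
    and gap: "\<And>\<alpha>. poly P \<alpha> = 0 \<or> poly Q \<alpha> = 0 \<or> poly (wronskian P Q) \<alpha> = 0 \<Longrightarrow>
                 \<not> (r1 < av (a - \<alpha>) \<and> av (a - \<alpha>) < r2)"
    and deg: "degree P \<le> d" "degree Q \<le> d"
  defines "Z \<equiv> root_count P {\<alpha>. av (a - \<alpha>) \<le> r1}"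
    and "N \<equiv> root_count Q {\<alpha>. av (a - \<alpha>) \<le> r1}"
  assumes "Z \<noteq> N"
  shows "root_count (wronskian P Q) {\<alpha>. av (a - \<alpha>) \<le> r1} + 1 = Z + N"
proof -
  let ?W = "wronskian P Q"
  have le: "root_count p S \<le> degree p" for p S
    using order_trans[OF size_mset_mono[OF multiset_filter_subset] size_proots_le]
    by (simp add: root_count_def)
  \<comment> \<open>Root counts are bounded by degrees, so \<open>Z - N\<close> is a nonzero integer
    of size at most \<open>d\<close>, a unit by tameness.\<close>
  have ZN: "av (of_nat Z - of_nat N) = 1"
  proof (cases "N < Z")
    case True
    have "Z \<le> d" using le[of P] deg(1) unfolding Z_def by (rule order_trans)
    thus ?thesis using tame[of "Z - N"] True by (simp add: of_nat_diff)
  next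
    case False
    have "N \<le> d" using le[of Q] deg(2) unfolding N_def by (rule order_trans)
    thus ?thesis
      using tame[of "N - Z"] False \<open>Z \<noteq> N\<close> by (simp add: of_nat_diff av_diff_commute[of "of_nat Z"])
  qed
  have key: "av (poly ?W z) * av (z - a) = av (poly P z) * av (poly Q z)"
    and nz: "poly P z \<noteq> 0" "poly Q z \<noteq> 0"
    if z: "r1 < av (z - a)" "av (z - a) < r2" for z
  proof -
    show nz: "poly P z \<noteq> 0" "poly Q z \<noteq> 0" using gap[of z] z by (auto simp: av_diff_commute)
    let ?L = "\<lambda>p. \<Sum>\<alpha>\<in>#proots p. (z - a) / (z - \<alpha>)"
    have sz: "size (filter_mset (\<lambda>\<alpha>. av (a - \<alpha>) < av (z - a)) (proots p)) =
                root_count p {\<alpha>. av (a - \<alpha>) \<le> r1}" if "p = P \<or> p = Q" for p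
      unfolding root_count_def
      by (intro arg_cong[where f = size] filter_mset_cong) (use that gap z assms(1,2) in force)+
    have ap: "av (?L p - of_nat (root_count p {\<alpha>. av (a - \<alpha>) \<le> r1})) < 1" if p: "p = P \<or> p = Q" for p
      unfolding sz[OF p, symmetric]
      by (rule log_derivative_approx) (use p gap z assms(1,2) in force)
    have "av ((?L P - of_nat Z) - (?L Q - of_nat N)) < av (of_nat Z - of_nat N)"
      unfolding ZN using ultrametric_diff_less[OF ap[of P] ap[of Q]] by (simp add: Z_def N_def)
    from av_add_eq[OF this] have "av (?L P - ?L Q) = 1" using ZN by (simp add: algebra_simps)
    moreover have "poly ?W z * (z - a) = poly P z * poly Q z * (?L P - ?L Q)"
    proof -
      have L: "?L p = (z - a) * (\<Sum>\<alpha>\<in>#proots p. 1 / (z - \<alpha>))" for p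
        by (simp add: sum_mset_distrib_left)
      show ?thesis unfolding L
        by (simp add: wronskian_def poly_pderiv_proots nz algebra_simps)
    qed
    ultimately show "av (poly ?W z) * av (z - a) = av (poly P z) * av (poly Q z)"
      by (metis mult mult.right_neutral)
  qed
  \<comment> \<open>Two monomials in the radius that agree at two different positive radii have the
    same exponent.\<close>
  obtain x1 where x1: "r1 < av x1" "av x1 < r2" using exists_av_between assms(3,4) by blast
  obtain x2 where x2: "av x1 < av x2" "av x2 < r2" using exists_av_between x1 nonneg by blast
  have W0: "?W \<noteq> 0"
  proof
    assume "?W = 0"
    thus False using key[of "x1 + a"] nz[of "x1 + a"] x1 by (simp add: eq_0_iff)
  qed
  let ?c = "root_count ?W {\<alpha>. av (a - \<alpha>) \<le> r1}"
  obtain KP where KP: "KP > 0" "\<And>r. r1 \<le> r \<Longrightarrow> r \<le> r2 \<Longrightarrow> gauss_norm P a r = KP * r ^ Z"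
    using gauss_norm_monomial[OF assms(1,3,4), of a] gap unfolding Z_def by metis
  obtain KQ where KQ: "KQ > 0" "\<And>r. r1 \<le> r \<Longrightarrow> r \<le> r2 \<Longrightarrow> gauss_norm Q a r = KQ * r ^ N"
    using gauss_norm_monomial[OF assms(2,3,4), of a] gap unfolding N_def by metis
  obtain KW where KW: "KW > 0" "\<And>r. r1 \<le> r \<Longrightarrow> r \<le> r2 \<Longrightarrow> gauss_norm ?W a r = KW * r ^ ?c"
    using gauss_norm_monomial[OF W0 assms(3,4), of a] gap by metis
  have eq: "KW * av x ^ (?c + 1) = KP * KQ * av x ^ (Z + N)" if "r1 < av x" "av x < r2" for x
  proof -
    have g: "av (poly p (x + a)) = gauss_norm p a (av x)" if "p = P \<or> p = Q \<or> p = ?W" for p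
      using av_poly_eq_gauss_norm[of p a "x + a"] gap that \<open>r1 < av x\<close> \<open>av x < r2\<close> by force
    from key[of "x + a"] that show ?thesis by (simp add: g KP KQ KW power_add mult_ac)
  qed
  have p1: "0 < av x1" using x1 assms(3) by linarith
  define t where "t = av x2 / av x1"
  have t: "t > 1" using x2 p1 by (simp add: t_def)
  have x2t: "av x2 = t * av x1" using p1 by (simp add: t_def)
  have "t ^ (?c + 1) * (KW * av x1 ^ (?c + 1)) = t ^ (Z + N) * (KP * KQ * av x1 ^ (Z + N))"
    using eq[of x2] x1 x2 unfolding x2t power_mult_distrib by (simp only: mult_ac)
  moreover have "KW * av x1 ^ (?c + 1) = KP * KQ * av x1 ^ (Z + N)" using eq[of x1] x1 by simp
  ultimately have "t ^ (?c + 1) * (KP * KQ * av x1 ^ (Z + N)) = t ^ (Z + N) * (KP * KQ * av x1 ^ (Z + N))"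
    by (simp only:)
  moreover have "KP * KQ * av x1 ^ (Z + N) \<noteq> 0" using KP(1) KQ(1) p1 by simp
  ultimately have "t ^ (?c + 1) = t ^ (Z + N)" using mult_right_cancel by blast
  thus ?thesis using t by (simp only: power_inject_exp)
qed

section \<open>Radii at which the generic ratio crosses \<open>s\<close>\<close>

lemma gauss_norm_no_roots:
  assumes "p \<noteq> 0" "\<And>\<alpha>. poly p \<alpha> = 0 \<Longrightarrow> R \<le> av \<alpha>" "0 \<le> r" "r \<le> R"
  shows "gauss_norm p 0 r = av (poly p 0)"
proof (cases "R > 0")
  case True
  then obtain K where K: "\<And>r. 0 \<le> r \<Longrightarrow> r \<le> R \<Longrightarrow>
      gauss_norm p 0 r = K * r ^ root_count p {\<alpha>. av (0 - \<alpha>) \<le> 0}"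
    using gauss_norm_monomial[of p 0 R 0] assms(1,2) by fastforce
  have "root_count p {\<alpha>. av (0 - \<alpha>) \<le> 0} = root_count p {}"
    using assms(2) True by (intro root_count_cong) force
  hence "root_count p {\<alpha>. av (0 - \<alpha>) \<le> 0} = 0" by (simp add: root_count_def)
  with K[of 0] K[of r] assms(3,4) True show ?thesis
    by (simp add: gauss_norm_0)
next
  case False
  hence "r = 0" using assms(3,4) by simp
  thus ?thesis by (simp add: gauss_norm_0)
qed

lemma gap_above:
  assumes "finite S" "r < r'"
  shows "\<exists>r2. r < r2 \<and> r2 < r' \<and> (\<forall>\<alpha>\<in>S. \<not> (r < av (a - \<alpha>) \<and> av (a - \<alpha>) < r2))"
  using exists_gap[of "(\<lambda>\<alpha>. av (a - \<alpha>)) ` S" r r'] assms by fastforce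

text \<open>Just above \<open>r\<close> the generic ratio is a constant times the power of the
  radius with exponent zeros minus poles. It falls from at least \<open>s\<close> to below
  \<open>s\<close>, so the exponent is negative.\<close>

lemma more_poles_than_zeros:
  assumes PQ: "P \<noteq> 0" "Q \<noteq> 0" and cop: "poly P a \<noteq> 0 \<or> poly Q a \<noteq> 0"
    and s: "s > 0" and r: "0 \<le> r" "r < r'"
    and ge: "s * gauss_norm Q a r \<le> gauss_norm P a r"
    and less: "\<And>\<rho>. r < \<rho> \<Longrightarrow> \<rho> < r' \<Longrightarrow> gauss_norm P a \<rho> < s * gauss_norm Q a \<rho>"
  shows "root_count P {\<alpha>. av (a - \<alpha>) \<le> r} < root_count Q {\<alpha>. av (a - \<alpha>) \<le> r}"
    (is "?Z < ?N")
proof (rule ccontr)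
  assume "\<not> ?Z < ?N"
  hence le: "?N \<le> ?Z" by simp
  have "finite ({\<alpha>. poly P \<alpha> = 0} \<union> {\<alpha>. poly Q \<alpha> = 0})" using PQ by (simp add: poly_roots_finite)
  from gap_above[OF this r(2), of a] obtain r2 where r2: "r < r2" "r2 < r'"
    "\<And>\<alpha>. poly P \<alpha> = 0 \<or> poly Q \<alpha> = 0 \<Longrightarrow> \<not> (r < av (a - \<alpha>) \<and> av (a - \<alpha>) < r2)" by auto
  obtain KP where KP: "KP > 0" "\<And>x. r \<le> x \<Longrightarrow> x \<le> r2 \<Longrightarrow> gauss_norm P a x = KP * x ^ ?Z"
    using gauss_norm_monomial[OF PQ(1) r(1) r2(1), of a] r2(3) by metis
  obtain KQ where KQ: "KQ > 0" "\<And>x. r \<le> x \<Longrightarrow> x \<le> r2 \<Longrightarrow> gauss_norm Q a x = KQ * x ^ ?N"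
    using gauss_norm_monomial[OF PQ(2) r(1) r2(1), of a] r2(3) by metis
  have h1: "s * KQ * r ^ ?N \<le> KP * r ^ ?Z" using ge KP(2)[of r] KQ(2)[of r] r2 by simp
  have h2: "KP * r2 ^ ?Z < s * KQ * r2 ^ ?N" using less[of r2] KP(2)[of r2] KQ(2)[of r2] r2 by simp
  have split: "x ^ ?Z = x ^ (?Z - ?N) * x ^ ?N" for x :: real
    using le by (simp flip: power_add)
  have r2p: "r2 > 0" using r r2 by simp
  from h2 have h2': "KP * r2 ^ (?Z - ?N) < s * KQ" using r2p unfolding split[of r2] by simp
  have mono: "KP * r ^ (?Z - ?N) \<le> KP * r2 ^ (?Z - ?N)"
    using KP(1) r r2 by (intro mult_left_mono power_mono) simp_all
  show False
  \<comment> \<open>In this case both norms vanish at radius \<open>0\<close> and the inequality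
    there says nothing; but then \<open>a\<close> is a common root.\<close>
  proof (cases "r = 0 \<and> ?N > 0")
    case True
    hence "?N > 0" "?Z > 0" "r = 0" using le by auto
    hence "av (poly P a) = 0" "av (poly Q a) = 0"
      using KP(2)[of r] KQ(2)[of r] r2(1) by (simp_all flip: gauss_norm_0)
    thus False using cop by (simp add: eq_0_iff)
  next
    case False
    hence "r ^ ?N > 0" using r by (cases "r = 0") auto
    moreover have "s * KQ * r ^ ?N \<le> (KP * r ^ (?Z - ?N)) * r ^ ?N"
      using h1 unfolding split[of r] by (simp add: mult.assoc)
    ultimately have "s * KQ \<le> KP * r ^ (?Z - ?N)" by simp
    with mono h2' show False by simp
  qed
qed

lemma compact_gauss_norm_ge:
  "compact {r \<in> {0..b}. 0 \<le> gauss_norm P x r - s * gauss_norm Q x r}"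
proof -
  have "closed {r. 0 \<le> gauss_norm P x r - s * gauss_norm Q x r}"
    by (intro closed_Collect_le continuous_intros continuous_on_gauss_norm)
  moreover have "{r \<in> {0..b}. 0 \<le> gauss_norm P x r - s * gauss_norm Q x r} =
      {0..b} \<inter> {r. 0 \<le> gauss_norm P x r - s * gauss_norm Q x r}" by auto
  ultimately show ?thesis by (simp add: compact_Int_closed)
qed

text \<open>From radius \<open>av x\<close> on, the discs about \<open>x\<close> and about
  \<open>0\<close> coincide and the ratio is below \<open>s\<close>. So the last radius with ratio
  at least \<open>s\<close>, which exists by compactness, is smaller than \<open>av x\<close>; this
  keeps \<open>0\<close> out of the disc.\<close>

lemma last_radius:
  assumes below: "\<And>\<rho>. 0 \<le> \<rho> \<Longrightarrow> \<rho> < R \<Longrightarrow> gauss_norm P 0 \<rho> < s * gauss_norm Q 0 \<rho>"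
    and x: "av x < R" and ge: "s * av (poly Q x) \<le> av (poly P x)"
  shows "\<exists>r\<ge>0. r < av x \<and> s * gauss_norm Q x r \<le> gauss_norm P x r \<and>
           (\<forall>\<rho>. r < \<rho> \<and> \<rho> < R \<longrightarrow> gauss_norm P x \<rho> < s * gauss_norm Q x \<rho>)"
proof -
  let ?h = "\<lambda>r. gauss_norm P x r - s * gauss_norm Q x r"
  have big: "?h \<rho> < 0" if "av x \<le> \<rho>" "\<rho> < R" for \<rho>
    using below[of \<rho>] that nonneg[of x] gauss_norm_cong[of x 0 \<rho>] by simp
  define T where "T = {r \<in> {0..av x}. 0 \<le> ?h r}"
    have "compact T" unfolding T_def by (rule compact_gauss_norm_ge)
  moreover have "0 \<in> T" using ge nonneg by (simp add: T_def gauss_norm_0)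
  ultimately obtain r where r: "r \<in> T" "\<And>t. t \<in> T \<Longrightarrow> t \<le> r"
    using compact_attains_sup[of T] by blast
  have "?h \<rho> < 0" if "r < \<rho>" "\<rho> < R" for \<rho>
  proof (cases "av x \<le> \<rho>")
    case False
    show ?thesis
    proof (rule ccontr)
      assume "\<not> ?h \<rho> < 0"
      hence "\<rho> \<in> T" using False that r(1) by (simp add: T_def)
      thus False using r(2)[of \<rho>] that by simp
    qed
  qed (use big that in blast)
  moreover have "r < av x"
  proof (rule ccontr)
    assume "\<not> r < av x"
    hence "r = av x" using r(1) by (simp add: T_def)
    thus False using big[of r] r(1) x by (simp add: T_def)
  qed
  ultimately show ?thesis using r(1) by (intro exI[of _ r]) (auto simp: T_def)
qed

text \<open>\<open>R\<close> is the first radius about \<open>0\<close> at which the generic ratio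
  reaches \<open>s\<close>, and \<open>r1\<close> the largest modulus of a root below it. The last
  alternative covers a ratio that never reaches \<open>s\<close>, where \<open>R\<close> is taken
  beyond all roots.\<close>

lemma first_radius:
  assumes PQ: "P \<noteq> 0" "Q \<noteq> 0" "W \<noteq> 0" and deg: "degree P < degree Q" and s: "s > 0"
    and 0: "poly P 0 = 0" "poly Q 0 \<noteq> 0"
  obtains R r1 where "0 \<le> r1" "r1 < R"
    "\<And>\<rho>. 0 \<le> \<rho> \<Longrightarrow> \<rho> < R \<Longrightarrow> gauss_norm P 0 \<rho> < s * gauss_norm Q 0 \<rho>"
    "\<And>\<alpha>. poly P \<alpha> = 0 \<or> poly Q \<alpha> = 0 \<or> poly W \<alpha> = 0 \<Longrightarrow> av \<alpha> < R \<Longrightarrow> av \<alpha> \<le> r1"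
    "root_count P {\<alpha>. av \<alpha> \<le> r1} \<noteq> root_count Q {\<alpha>. av \<alpha> \<le> r1}"
    "s * gauss_norm Q 0 R \<le> gauss_norm P 0 R \<or> (\<forall>\<alpha>. poly Q \<alpha> = 0 \<longrightarrow> av \<alpha> < R)"
proof -
  let ?h = "\<lambda>r. gauss_norm P 0 r - s * gauss_norm Q 0 r"
  let ?A = "{\<alpha>. poly P \<alpha> = 0} \<union> {\<alpha>. poly Q \<alpha> = 0} \<union> {\<alpha>. poly W \<alpha> = 0}"
  have finA: "finite ?A" using PQ by (simp add: poly_roots_finite)
  show ?thesis
  proof (cases "\<exists>\<rho>0\<ge>0. 0 \<le> ?h \<rho>0")
    case True
    then obtain \<rho>0 where \<rho>0: "\<rho>0 \<ge> 0" "0 \<le> ?h \<rho>0" by blast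
    define T where "T = {r \<in> {0..\<rho>0}. 0 \<le> ?h r}"
    have "compact T" unfolding T_def by (rule compact_gauss_norm_ge)
    moreover have "\<rho>0 \<in> T" using \<rho>0 by (simp add: T_def)
    ultimately obtain R where R: "R \<in> T" "\<And>t. t \<in> T \<Longrightarrow> R \<le> t"
      using compact_attains_inf[of T] by blast
    have "?h 0 < 0" using s 0 by (simp add: gauss_norm_0 av_pos_iff)
    with R(1) have Rp: "R > 0" by (cases "R = 0") (auto simp: T_def)
    have below: "?h \<rho> < 0" if "0 \<le> \<rho>" "\<rho> < R" for \<rho>
      using R(1) R(2)[of \<rho>] that by (force simp: T_def)
    define r1 where "r1 = Max (insert 0 {x \<in> av ` ?A. x < R})"
    have fin: "finite (insert 0 {x \<in> av ` ?A. x < R})" using finA by simp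
    have r1: "0 \<le> r1" "r1 < R" and le: "\<And>\<alpha>. \<alpha> \<in> ?A \<Longrightarrow> av \<alpha> < R \<Longrightarrow> av \<alpha> \<le> r1"
      unfolding r1_def using fin Rp by (auto intro!: Max_ge)
    have gap: "\<not> (r1 < av (0 - \<alpha>) \<and> av (0 - \<alpha>) < R)" if "\<alpha> \<in> ?A" for \<alpha>
      using le[OF that] by auto
    let ?Z = "root_count P {\<alpha>. av (0 - \<alpha>) \<le> r1}" and ?N = "root_count Q {\<alpha>. av (0 - \<alpha>) \<le> r1}"
    obtain KP where KP: "\<And>x. r1 \<le> x \<Longrightarrow> x \<le> R \<Longrightarrow> gauss_norm P 0 x = KP * x ^ ?Z"
      using gauss_norm_monomial[OF PQ(1) r1 gap] by auto
    obtain KQ where KQ: "\<And>x. r1 \<le> x \<Longrightarrow> x \<le> R \<Longrightarrow> gauss_norm Q 0 x = KQ * x ^ ?N"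
      using gauss_norm_monomial[OF PQ(2) r1 gap] by auto
    \<comment> \<open>With equal exponents the ratio would be constant from \<open>r1\<close> to
      \<open>R\<close>, yet it is below \<open>s\<close> at one end and at least \<open>s\<close> at
      the other.\<close>
    have "?Z \<noteq> ?N"
    proof
      assume eq: "?Z = ?N"
      have a: "KP * r1 ^ ?N < s * (KQ * r1 ^ ?N)"
        using below[of r1] r1 KP[of r1] KQ[of r1] unfolding eq by simp
      have "s * (KQ * R ^ ?N) \<le> KP * R ^ ?N"
        using R(1) r1 KP[of R] KQ[of R] unfolding eq by (simp add: T_def)
      hence "s * KQ * R ^ ?N \<le> KP * R ^ ?N" by (simp only: mult.assoc)
      hence "s * KQ \<le> KP" by (rule mult_right_le_imp_le) (use Rp in simp)
      hence "s * KQ * r1 ^ ?N \<le> KP * r1 ^ ?N" by (rule mult_right_mono) (use r1 in simp)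
      thus False using a by simp
    qed
    show ?thesis
    proof (rule that[of r1 R])
      show "gauss_norm P 0 \<rho> < s * gauss_norm Q 0 \<rho>" if "0 \<le> \<rho>" "\<rho> < R" for \<rho>
        using below[OF that] by simp
      show "root_count P {\<alpha>. av \<alpha> \<le> r1} \<noteq> root_count Q {\<alpha>. av \<alpha> \<le> r1}"
        using \<open>?Z \<noteq> ?N\<close> by simp
      show "s * gauss_norm Q 0 R \<le> gauss_norm P 0 R \<or> (\<forall>\<alpha>. poly Q \<alpha> = 0 \<longrightarrow> av \<alpha> < R)"
        using R(1) by (simp add: T_def)
    qed (use r1 le in auto)
  next
    case False
    define r1 where "r1 = Max (insert 0 (av ` ?A))"
    have fin: "finite (insert 0 (av ` ?A))" using finA by simp
    have r1: "0 \<le> r1" and le: "\<And>\<alpha>. \<alpha> \<in> ?A \<Longrightarrow> av \<alpha> \<le> r1"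
      unfolding r1_def using fin by (auto intro!: Max_ge)
    have "root_count p {\<alpha>. av \<alpha> \<le> r1} = degree p" if "p = P \<or> p = Q" for p
    proof -
      have "root_count p {\<alpha>. av \<alpha> \<le> r1} = root_count p UNIV"
        using that le by (intro root_count_cong) auto
      thus ?thesis using that PQ by (auto simp: root_count_def size_proots_alg_closed)
    qed
    hence ne: "root_count P {\<alpha>. av \<alpha> \<le> r1} \<noteq> root_count Q {\<alpha>. av \<alpha> \<le> r1}"
      using deg by simp
    show ?thesis
    \<comment> \<open>Any radius beyond all roots will do; the counts are then the degrees, which
      differ.\<close>
    proof (rule that[of r1 "r1 + 1"])
      show "gauss_norm P 0 \<rho> < s * gauss_norm Q 0 \<rho>" if "0 \<le> \<rho>" for \<rho>
        using False that by force
      show "s * gauss_norm Q 0 (r1 + 1) \<le> gauss_norm P 0 (r1 + 1) \<or> (\<forall>\<alpha>. poly Q \<alpha> = 0 \<longrightarrow> av \<alpha> < r1 + 1)"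
        using le by fastforce
    qed (use r1 le ne in auto)
  qed
qed

text \<open>Let \<open>E\<close> be the largest open disc around \<open>0\<close> on whose concentric circles \<open>|P / Q| < s\<close>
  generically, and remove from it the maximal closed discs (holes) around poles on which
  generically \<open>|P / Q| \<ge> s\<close>. On the rest \<open>V\<close> the function is smaller than \<open>s\<close>, and applying
  the Wronskian count to \<open>E\<close> and to every hole shows that the number of critical points in \<open>V\<close> outside the
  zeros is the number of distinct zeros plus the number of holes minus one. If there are none, then
  \<open>0\<close> is the only zero and there is no pole.\<close>

lemma proper_disc_expansion:
  assumes coprime: "\<And>z. poly P z \<noteq> 0 \<or> poly Q z \<noteq> 0"
    and deg: "degree P < degree Q" "degree Q \<le> d" and s: "s > 0"
    and P0: "poly P 0 = 0" and dP0: "poly (pderiv P) 0 \<noteq> 0"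
    and nocrit: "\<And>c. poly (wronskian P Q) c = 0 \<Longrightarrow> poly P c \<noteq> 0 \<Longrightarrow>
                     \<not> av (poly P c) < s * av (poly Q c)"
    and z: "av z * av (poly (pderiv P) 0) < s * av (poly Q 0)"
  shows "av (poly P z) = av (poly (pderiv P) 0) * av z \<and> av (poly Q z) = av (poly Q 0)"
proof -
  let ?W = "wronskian P Q"
  have Q0: "poly Q 0 \<noteq> 0" using coprime[of 0] P0 by simp
  have PQ: "P \<noteq> 0" "Q \<noteq> 0" using dP0 Q0 by auto
  have W0: "poly ?W 0 \<noteq> 0" using P0 Q0 dP0 by (simp add: wronskian_def)
  hence W: "?W \<noteq> 0" by auto
  have degs: "degree P \<le> d" "degree Q \<le> d" using deg by simp_all
  obtain R r1 where r1: "0 \<le> r1" "r1 < R"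
    and below: "\<And>\<rho>. 0 \<le> \<rho> \<Longrightarrow> \<rho> < R \<Longrightarrow> gauss_norm P 0 \<rho> < s * gauss_norm Q 0 \<rho>"
    and r1R: "\<And>\<alpha>. poly P \<alpha> = 0 \<or> poly Q \<alpha> = 0 \<or> poly ?W \<alpha> = 0 \<Longrightarrow> av \<alpha> < R \<Longrightarrow> av \<alpha> \<le> r1"
    and ZN: "root_count P {\<alpha>. av \<alpha> \<le> r1} \<noteq> root_count Q {\<alpha>. av \<alpha> \<le> r1}"
    and R: "s * gauss_norm Q 0 R \<le> gauss_norm P 0 R \<or> (\<forall>\<alpha>. poly Q \<alpha> = 0 \<longrightarrow> av \<alpha> < R)"
    by (rule first_radius[OF PQ W deg(1) s P0 Q0]) (rule that, assumption+)
  define E where "E = {\<alpha>. av \<alpha> < R}"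
  have count_E: "root_count p E = root_count p {\<alpha>. av \<alpha> \<le> r1}" if "p = P \<or> p = Q \<or> p = ?W" for p
    unfolding E_def using r1R that r1 by (intro root_count_cong) auto
  have gap0: "\<not> (r1 < av (0 - \<alpha>) \<and> av (0 - \<alpha>) < R)"
    if "poly P \<alpha> = 0 \<or> poly Q \<alpha> = 0 \<or> poly ?W \<alpha> = 0" for \<alpha>
    using r1R[OF that] by auto
  have root_count_wronskian_0: "root_count ?W {\<alpha>. av (0 - \<alpha>) \<le> r1} + 1 =
      root_count P {\<alpha>. av (0 - \<alpha>) \<le> r1} + root_count Q {\<alpha>. av (0 - \<alpha>) \<le> r1}"
    by (rule root_count_wronskian[OF PQ r1 gap0 degs]) (use ZN in simp_all)
  have CE: "root_count ?W E + 1 = root_count P E + root_count Q E"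
    using root_count_wronskian_0 by (simp add: count_E)

  define B where "B = {b \<in> E. poly Q b = 0}"
  define last where "last b r \<longleftrightarrow> 0 \<le> r \<and> r < av b \<and>
      s * gauss_norm Q b r \<le> gauss_norm P b r \<and>
      (\<forall>\<rho>. r < \<rho> \<and> \<rho> < R \<longrightarrow> gauss_norm P b \<rho> < s * gauss_norm Q b \<rho>)" for b r
  have "\<exists>r. last b r" if "b \<in> B" for b
    unfolding last_def
    by (rule last_radius[of R P s Q b]) (use below that in \<open>auto simp: B_def E_def nonneg\<close>)
  then obtain rad where "\<And>b. b \<in> B \<Longrightarrow> last b (rad b)" by metis
  hence rad: "rad b \<ge> 0" "rad b < av b" "s * gauss_norm Q b (rad b) \<le> gauss_norm P b (rad b)"
      "\<And>\<rho>. rad b < \<rho> \<Longrightarrow> \<rho> < R \<Longrightarrow> gauss_norm P b \<rho> < s * gauss_norm Q b \<rho>" if "b \<in> B" for b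
    using that unfolding last_def by blast+
  have radR: "rad b < R" if "b \<in> B" for b using rad(2)[OF that] that by (simp add: B_def E_def)
  define hole where "hole b = {\<alpha>. av (b - \<alpha>) \<le> rad b}" for b
  \<comment> \<open>The disc of radius \<open>\<rho>\<close> about \<open>x\<close> may be recentred
    at \<open>b\<close>, where \<open>rad b\<close> is the last radius with ratio at least
    \<open>s\<close>.\<close>
  have hole_max: "\<rho> \<le> rad b"
    if "b \<in> B" "av (b - x) \<le> \<rho>" "\<rho> < R" "s * gauss_norm Q x \<rho> \<le> gauss_norm P x \<rho>" for b x \<rho>
  proof (rule ccontr)
    assume "\<not> \<rho> \<le> rad b"
    hence "gauss_norm P b \<rho> < s * gauss_norm Q b \<rho>" using rad(4)[OF that(1)] that(3) by simp
    thus False using that(4) gauss_norm_cong[OF that(2)] by simp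
  qed
  \<comment> \<open>If two holes meet, the larger one contains both centres, and maximality of the
    smaller one equalizes the radii.\<close>
  have hole_eq: "hole b = hole c" if bc: "b \<in> B" "c \<in> B" and x: "x \<in> hole b" "x \<in> hole c" for b c x
  proof -
    have swap: "av (c - b) \<le> max (rad b) (rad c)" "av (b - c) \<le> max (rad b) (rad c)"
      using x ultrametric_diff[of "b - x" "c - x"] ultrametric_diff[of "c - x" "b - x"]
      by (auto simp: hole_def)
    have "rad b = rad c"
    proof (cases "rad b \<le> rad c")
      case True
      with hole_max[OF bc(1), of c "rad c"] rad[OF bc(2)] radR[OF bc(2)] swap show ?thesis by simp
    next
      case False
      with hole_max[OF bc(2), of b "rad b"] rad[OF bc(1)] radR[OF bc(1)] swap show ?thesis by simp
    qed
    moreover have "av (b - \<alpha>) \<le> rad b \<longleftrightarrow> av (c - \<alpha>) \<le> rad b" for \<alpha>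
      using swap \<open>rad b = rad c\<close> ultrametric[of "b - c" "c - \<alpha>"] ultrametric[of "c - b" "b - \<alpha>"]
      by auto
    ultimately show ?thesis by (simp add: hole_def)
  qed
  have hole_E: "hole b \<subseteq> E" if "b \<in> B" for b
  proof
    fix x assume x: "x \<in> hole b"
    have "av (b - (b - x)) < R"
      by (rule ultrametric_diff_less) (use radR[OF that] x that in \<open>auto simp: hole_def B_def E_def\<close>)
    thus "x \<in> E" by (simp add: E_def)
  qed
  have finB: "finite B" using PQ by (simp add: B_def poly_roots_finite)
  define V where "V = E - \<Union> (hole ` B)"
  have disj: "pairwise disjnt (hole ` B)"
    using hole_eq by (auto simp: pairwise_def disjnt_def)
  have split: "root_count p E = root_count p V + (\<Sum>H\<in>hole ` B. root_count p H)" for p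
  proof -
    have "E = V \<union> \<Union> (hole ` B)" "V \<inter> \<Union> (hole ` B) = {}" using hole_E by (auto simp: V_def)
    thus ?thesis using root_count_Un[of V "\<Union> (hole ` B)" p] finB
      by (simp add: root_count_Union_disjoint[OF _ disj])
  qed
  have CH: "root_count ?W H + 1 = root_count P H + root_count Q H" if H: "H \<in> hole ` B" for H
  proof -
    obtain b where b: "b \<in> B" "H = hole b" using H by blast
    have "finite ({\<alpha>. poly P \<alpha> = 0} \<union> {\<alpha>. poly Q \<alpha> = 0} \<union> {\<alpha>. poly ?W \<alpha> = 0})"
      using PQ W by (simp add: poly_roots_finite)
    from gap_above[OF this radR[OF b(1)], of b]
    obtain r2 where r2: "rad b < r2" "\<And>\<alpha>. poly P \<alpha> = 0 \<or> poly Q \<alpha> = 0 \<or> poly ?W \<alpha> = 0 \<Longrightarrow>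
        \<not> (rad b < av (b - \<alpha>) \<and> av (b - \<alpha>) < r2)" by auto
    have "root_count P H < root_count Q H"
      unfolding b(2) hole_def by (rule more_poles_than_zeros[OF PQ coprime s rad(1)[OF b(1)] radR[OF b(1)] rad(3)[OF b(1)]])
         (rule rad(4)[OF b(1)])
    thus ?thesis
      unfolding b(2) hole_def by (intro root_count_wronskian[OF PQ rad(1)[OF b(1)] r2(1) _ degs] r2(2)) auto
  qed
  \<comment> \<open>If the ratio at \<open>x\<close> were at least \<open>s\<close>, the last disc
    about \<open>x\<close> would have more poles than zeros; by maximality it lies in the hole of
    one of its poles.\<close>
  have V_small: "av (poly P x) < s * av (poly Q x)" if x: "x \<in> V" for x
  proof (rule ccontr)
    assume "\<not> ?thesis"
    hence "\<exists>r\<ge>0. r < av x \<and> s * gauss_norm Q x r \<le> gauss_norm P x r \<and>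
        (\<forall>\<rho>. r < \<rho> \<and> \<rho> < R \<longrightarrow> gauss_norm P x \<rho> < s * gauss_norm Q x \<rho>)"
      by (intro last_radius) (use below x in \<open>auto simp: V_def E_def\<close>)
    then obtain r where r: "r \<ge> 0" "r < av x" "s * gauss_norm Q x r \<le> gauss_norm P x r"
      "\<And>\<rho>. r < \<rho> \<Longrightarrow> \<rho> < R \<Longrightarrow> gauss_norm P x \<rho> < s * gauss_norm Q x \<rho>"
      by blast
    have rR: "r < R" using r x by (auto simp: V_def E_def)
    have "root_count P {\<alpha>. av (x - \<alpha>) \<le> r} < root_count Q {\<alpha>. av (x - \<alpha>) \<le> r}"
      by (rule more_poles_than_zeros[OF PQ coprime s r(1) rR r(3)]) (rule r(4))
    hence "root_count Q {\<alpha>. av (x - \<alpha>) \<le> r} \<noteq> 0" by linarith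
    moreover have "root_count Q {} = 0" by (simp add: root_count_def)
    ultimately obtain b where b: "poly Q b = 0" "av (x - b) \<le> r"
      using root_count_cong[of Q "{\<alpha>. av (x - \<alpha>) \<le> r}" "{}"] by auto
    have "av (x - (x - b)) < R"
      by (rule ultrametric_diff_less) (use b rR x in \<open>auto simp: V_def E_def\<close>)
    hence bB: "b \<in> B" using b by (simp add: B_def E_def)
    have "r \<le> rad b"
      using hole_max[OF bB, of x r] b rR r(3) by (simp add: av_diff_commute)
    hence "x \<in> hole b" using b by (simp add: hole_def av_diff_commute)
    thus False using x bB by (auto simp: V_def)
  qed
  \<comment> \<open>The count is applied to the disc of radius \<open>0\<close> about
    \<open>a\<close>, where it sees only the orders at that point.\<close>
  have order_W: "Polynomial.order a ?W + 1 = Polynomial.order a P" if a: "poly P a = 0" for a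
  proof -
    have pt: "root_count p {\<alpha>. av (a - \<alpha>) \<le> 0} = Polynomial.order a p" if "p \<noteq> 0" for p
    proof -
      have "av (a - \<alpha>) \<le> 0 \<longleftrightarrow> \<alpha> = a" for \<alpha> using av_pos_iff[of "a - \<alpha>"] by (auto simp: not_le[symmetric])
      hence "{\<alpha>. av (a - \<alpha>) \<le> 0 \<and> poly p \<alpha> = 0} = (if poly p a = 0 then {a} else {})" by auto
      thus ?thesis using root_count_altdef[OF that] order_0I[of p a] by simp
    qed
    have "finite ({\<alpha>. poly P \<alpha> = 0} \<union> {\<alpha>. poly Q \<alpha> = 0} \<union> {\<alpha>. poly ?W \<alpha> = 0})"
      using PQ W by (simp add: poly_roots_finite)
    from gap_above[OF this, of 0 1 a]
    obtain r2 where r2: "0 < r2" "\<And>\<alpha>. poly P \<alpha> = 0 \<or> poly Q \<alpha> = 0 \<or> poly ?W \<alpha> = 0 \<Longrightarrow>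
        \<not> (0 < av (a - \<alpha>) \<and> av (a - \<alpha>) < r2)" by auto
    have "Polynomial.order a Q = 0" using coprime[of a] a by (intro order_0I) auto
    moreover have "Polynomial.order a P \<noteq> 0" using a PQ by (simp add: order_root)
    ultimately show ?thesis
      using root_count_wronskian[OF PQ order_refl r2(1) r2(2) degs] by (simp add: pt PQ W)
  qed
  define Z where "Z = {\<alpha>. \<alpha> \<in> V \<and> poly P \<alpha> = 0}"
  have finZ: "finite Z" using PQ by (simp add: Z_def poly_roots_finite)
  \<comment> \<open>By \<open>nocrit\<close> every root of the Wronskian in \<open>V\<close> is a
    zero of \<open>P\<close>, and there its order is one less; the defect is the number of distinct
    zeros.\<close>
  have CV: "root_count ?W V + card Z = root_count P V"
  proof -
    have "root_count ?W V = (\<Sum>\<alpha>\<in>Z. Polynomial.order \<alpha> ?W)"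
      unfolding root_count_altdef[OF W]
    proof (rule sum.mono_neutral_left[OF finZ])
      show "{\<alpha> \<in> V. poly ?W \<alpha> = 0} \<subseteq> Z" using nocrit V_small by (auto simp: Z_def)
      show "\<forall>i\<in>Z - {\<alpha> \<in> V. poly ?W \<alpha> = 0}. Polynomial.order i ?W = 0"
        using order_0I[of ?W] by (auto simp: Z_def)
    qed
    hence "root_count ?W V + card Z = (\<Sum>\<alpha>\<in>Z. Polynomial.order \<alpha> ?W + 1)"
      by (simp only: sum.distrib card_eq_sum)
    also have "\<dots> = (\<Sum>\<alpha>\<in>Z. Polynomial.order \<alpha> P)" by (rule sum.cong) (use order_W in \<open>auto simp: Z_def\<close>)
    also have "\<dots> = root_count P V" by (simp add: root_count_altdef[OF PQ(1)] Z_def)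
    finally show ?thesis .
  qed
  have NV: "root_count Q V = 0"
  proof -
    have "b \<in> hole b" if "b \<in> B" for b using rad(1)[OF that] by (simp add: hole_def)
    hence "root_count Q V = root_count Q {}" by (intro root_count_cong) (auto simp: V_def B_def)
    thus ?thesis by (simp add: root_count_def)
  qed
  have "(\<Sum>H\<in>hole ` B. root_count ?W H + 1) = (\<Sum>H\<in>hole ` B. root_count P H + root_count Q H)"
    by (rule sum.cong) (simp_all only: CH)
  hence "(\<Sum>H\<in>hole ` B. root_count ?W H) + card (hole ` B) =
      (\<Sum>H\<in>hole ` B. root_count P H) + (\<Sum>H\<in>hole ` B. root_count Q H)"
    by (simp only: sum.distrib card_eq_sum)
  \<comment> \<open>Subtracting the hole counts from the count on \<open>E\<close> leaves
    \<open>V\<close>, where \<open>Q\<close> has no roots and the orders of \<open>P\<close>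
    cancel.\<close>
  hence "card Z + card (hole ` B) = 1"
    using CE CV NV split[of P] split[of Q] split[of ?W] by linarith
  moreover have "0 \<notin> hole b" if "b \<in> B" for b using rad(2)[OF that] by (simp add: hole_def)
  hence "0 \<in> Z" using r1 P0 by (auto simp: Z_def V_def E_def)
  hence "card Z > 0" using finZ by (auto simp: card_gt_0_iff)
  ultimately have card: "card Z = 1" "card (hole ` B) = 0" by auto
  hence Bempty: "B = {}" using finB by simp
  have Zs: "Z = {0}" using card(1) \<open>0 \<in> Z\<close> by (auto simp: card_1_singleton_iff)
  have Q_noroot: "R \<le> av \<alpha>" if "poly Q \<alpha> = 0" for \<alpha>
  proof (rule ccontr)
    assume "\<not> R \<le> av \<alpha>"
    hence "\<alpha> \<in> B" using that by (simp add: B_def E_def)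
    thus False using Bempty by simp
  qed
  have P_root: "R \<le> av \<alpha> \<or> \<alpha> = 0" if "poly P \<alpha> = 0" for \<alpha>
  proof (cases "R \<le> av \<alpha>")
    case False
    hence "\<alpha> \<in> Z" using that Bempty by (simp add: Z_def V_def E_def)
    thus ?thesis using Zs by simp
  qed simp
  obtain P1 where P1: "P = [:0, 1:] * P1" using P0 unfolding poly_eq_0_iff_dvd by auto
  have dP: "poly (pderiv P) 0 = poly P1 0" by (simp add: P1 pderiv_mult pderiv_pCons)
  have P1n: "P1 \<noteq> 0" using dP dP0 by auto
  have P1_noroot: "R \<le> av \<alpha>" if "poly P1 \<alpha> = 0" for \<alpha>
    using P_root[of \<alpha>] that dP dP0 by (auto simp: P1)
  have gP: "gauss_norm P 0 R = R * av (poly P1 0)"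
  proof -
    have "proots [:0::'a, 1:] = {#0#}" using proots_linear_factor[of "0::'a"] by simp
    hence "gauss_norm [:0, 1:] 0 R = R" using r1 by (simp add: gauss_norm_def)
    thus ?thesis
      using gauss_norm_no_roots[OF P1n, of R R] P1_noroot r1 unfolding P1 gauss_norm_mult by simp
  qed
  have gQ: "gauss_norm Q 0 R = av (poly Q 0)"
    using gauss_norm_no_roots[OF PQ(2), of R R] Q_noroot r1 by simp
  \<comment> \<open>\<open>E\<close> contains no pole although \<open>Q\<close> has a root, so the
    ratio does reach \<open>s\<close> at \<open>R\<close>. There it is \<open>R\<close> times its
    slope at \<open>0\<close>, which bounds \<open>R\<close> from below.\<close>
  have zR: "av z < R"
  proof (rule ccontr)
    assume nz: "\<not> av z < R"
    have "\<not> (\<forall>\<alpha>. poly Q \<alpha> = 0 \<longrightarrow> av \<alpha> < R)"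
    proof -
      obtain x where "poly Q x = 0" using alg_closed_imp_poly_has_root[of Q] deg by auto
      with Q_noroot[of x] show ?thesis by force
    qed
    hence "s * av (poly Q 0) \<le> R * av (poly P1 0)" using R unfolding gP gQ by blast
    also have "\<dots> \<le> av z * av (poly P1 0)" using nz nonneg by (intro mult_right_mono) auto
    finally show False using z by (simp add: dP)
  qed
  have const: "av (poly p z) = av (poly p 0)" if "p = P1 \<or> p = Q" for p
  proof -
    have p: "p \<noteq> 0" "\<And>\<alpha>. poly p \<alpha> = 0 \<Longrightarrow> R \<le> av \<alpha>" using that P1n PQ P1_noroot Q_noroot by auto
    have "av (poly p z) = gauss_norm p 0 (av (z - 0))"
      using p(2) zR by (intro av_poly_eq_gauss_norm) force
    thus ?thesis using gauss_norm_no_roots[OF p(1), of R "av z"] p(2) zR nonneg[of z] by simp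
  qed
  show ?thesis using const[of P1] const[of Q] by (simp add: P1 pderiv_mult pderiv_pCons mult mult.commute)
qed

end

section \<open>Homogenization and the chain rule for Wronskians\<close>

text \<open>The degree is an argument because numerator and denominator must be homogenized to a
  common degree, even if one of them has a smaller degree.\<close>

definition homog_eval :: "nat \<Rightarrow> 'a::comm_semiring_1 poly \<Rightarrow> 'a \<Rightarrow> 'a \<Rightarrow> 'a" where
  "homog_eval d p u v = (\<Sum>i\<le>d. coeff p i * (u ^ i * v ^ (d - i)))"

definition homog_subst :: "nat \<Rightarrow> 'a::comm_semiring_1 poly \<Rightarrow> 'a poly \<Rightarrow> 'a poly \<Rightarrow> 'a poly" where
  "homog_subst d p A B = (\<Sum>i\<le>d. smult (coeff p i) (A ^ i * B ^ (d - i)))"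

lemma poly_homog_subst:
  "poly (homog_subst d p A B) z = homog_eval d p (poly A z) (poly B z)"
  by (simp add: homog_subst_def homog_eval_def poly_sum)

lemma homog_eval_scale: "homog_eval d p (c * u) (c * v) = c ^ d * homog_eval d p u v"
proof -
  have "coeff p i * ((c * u) ^ i * (c * v) ^ (d - i)) = c ^ d * (coeff p i * (u ^ i * v ^ (d - i)))"
    if "i \<le> d" for i
  proof -
    have "c ^ d = c ^ i * c ^ (d - i)" using that by (simp flip: power_add)
    thus ?thesis by (simp add: power_mult_distrib mult_ac)
  qed
  thus ?thesis by (simp add: homog_eval_def sum_distrib_left)
qed

lemma poly_altdef_le:
  fixes p :: "'a::comm_semiring_1 poly"
  assumes "degree p \<le> d"
  shows "poly p x = (\<Sum>i\<le>d. coeff p i * x ^ i)"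
  unfolding poly_altdef using assms
  by (intro sum.mono_neutral_left) (auto intro!: le_degree)

lemma homog_eval_1_right: "degree p \<le> d \<Longrightarrow> homog_eval d p u 1 = poly p u"
  by (simp add: homog_eval_def poly_altdef_le)

lemma homog_eval_dehomogenize:
  fixes v :: "'a::field"
  assumes "degree p \<le> d" "v \<noteq> 0"
  shows "homog_eval d p u v = v ^ d * poly p (u / v)"
  using homog_eval_scale[of d p v "u / v" 1] assms by (simp add: homog_eval_1_right)

lemma homog_eval_0_right: "homog_eval d p u 0 = coeff p d * u ^ d"
proof -
  have "homog_eval d p u 0 = (\<Sum>i\<in>{d}. coeff p i * (u ^ i * 0 ^ (d - i)))"
    unfolding homog_eval_def by (rule sum.mono_neutral_right) (auto simp: power_0_left)
  thus ?thesis by simp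
qed

lemma coeff_mult_le_degree:
  fixes p q :: "'a::comm_semiring_1 poly"
  assumes "degree p \<le> m" "degree q \<le> n"
  shows "coeff (p * q) (m + n) = coeff p m * coeff q n"
proof -
  have "coeff (p * q) (m + n) = (\<Sum>i\<in>{m}. coeff p i * coeff q (m + n - i))"
    unfolding coeff_mult
  proof (rule sum.mono_neutral_right)
    show "\<forall>i\<in>{..m + n} - {m}. coeff p i * coeff q (m + n - i) = 0"
    proof
      fix i assume i: "i \<in> {..m + n} - {m}"
      show "coeff p i * coeff q (m + n - i) = 0"
      proof (cases "i > m")
        case True
        thus ?thesis using assms(1) by (simp add: coeff_eq_0)
      next
        case False
        hence "degree q < m + n - i" using i assms(2) by auto
        thus ?thesis by (simp add: coeff_eq_0)
      qed
    qed
  qed auto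
  thus ?thesis by simp
qed

lemma coeff_power_le_degree:
  fixes p :: "'a::comm_semiring_1 poly"
  assumes "degree p \<le> m"
  shows "degree (p ^ k) \<le> k * m \<and> coeff (p ^ k) (k * m) = coeff p m ^ k"
proof (induction k)
  case (Suc k)
  thus ?case using coeff_mult_le_degree[OF assms, of "p ^ k" "k * m"] assms
      order_trans[OF degree_mult_le[of p "p ^ k"]] by simp
qed simp

text \<open>The coefficient in the formal top degree is the value at infinity, so it obeys the same
  formula as all other values.\<close>

lemma homog_subst_top:
  fixes A B :: "'a::comm_semiring_1 poly"
  assumes "degree A \<le> e" "degree B \<le> e"
  shows "degree (homog_subst d p A B) \<le> d * e"
    and "coeff (homog_subst d p A B) (d * e) = homog_eval d p (coeff A e) (coeff B e)"
proof -
  have "degree (A ^ i * B ^ (d - i)) \<le> d * e \<and>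
        coeff (A ^ i * B ^ (d - i)) (d * e) = coeff A e ^ i * coeff B e ^ (d - i)" if "i \<le> d" for i
  proof -
    have "i * e + (d - i) * e = d * e" using that by (simp flip: add_mult_distrib)
    thus ?thesis
      using coeff_power_le_degree[OF assms(1), of i] coeff_power_le_degree[OF assms(2), of "d - i"]
        coeff_mult_le_degree[of "A ^ i" "i * e" "B ^ (d - i)" "(d - i) * e"]
        degree_mult_le[of "A ^ i" "B ^ (d - i)"] by simp
  qed
  thus "degree (homog_subst d p A B) \<le> d * e"
    "coeff (homog_subst d p A B) (d * e) = homog_eval d p (coeff A e) (coeff B e)"
    unfolding homog_subst_def homog_eval_def
    by (auto intro!: degree_sum_le order_trans[OF degree_smult_le] simp: coeff_sum)
qed

lemma wronskian_swap: "wronskian B A = - wronskian A B"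
  by (simp add: wronskian_def algebra_simps)

lemma wronskian_smult: "wronskian (smult a A) (smult b B) = smult (a * b) (wronskian A B)"
  by (simp add: wronskian_def pderiv_smult smult_diff_right mult_ac)

lemma wronskian_sum:
  "wronskian (\<Sum>i\<in>I. f i) (\<Sum>j\<in>J. g j) = (\<Sum>i\<in>I. \<Sum>j\<in>J. wronskian (f i) (g j))"
  by (simp add: wronskian_def higher_pderiv_sum[of 1, simplified] sum_product sum_subtractf)

text \<open>The monomials have equal degree, so their quotient is the power \<open>i - j\<close> of
  \<open>A / B\<close>, with logarithmic derivative \<open>i - j\<close> times that of
  \<open>A / B\<close>. The exponents are truncated only for \<open>i = j\<close>, when both sides
  vanish.\<close>

lemma wronskian_monomials:
  assumes "i + k = j + l"
  shows "wronskian (A ^ i * B ^ k) (A ^ j * B ^ l) =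
    smult (of_nat i - of_nat j) (A ^ (i + j - 1) * B ^ (k + l - 1) * wronskian A B)"
proof (cases "i = j")
  case True
  thus ?thesis using assms by (simp add: wronskian_def algebra_simps)
next
  case False
  define r where "r = i + j - 1"
  define t where "t = k + l - 1"
  have rt: "A ^ i * A ^ j = A * A ^ r" "B ^ k * B ^ l = B * B ^ t"
  proof -
    have "i + j = Suc r" "k + l = Suc t" using False assms unfolding r_def t_def by arith+
    thus "A ^ i * A ^ j = A * A ^ r" "B ^ k * B ^ l = B * B ^ t"
      by (simp_all flip: power_add)
  qed
  have dA: "pderiv (A ^ m) * A ^ m' = smult (of_nat m) (A ^ (m + m' - 1) * pderiv A)" for m m'
    by (cases m) (simp_all add: pderiv_power power_add mult_ac del: power_Suc)
  have dB: "pderiv (B ^ m) * B ^ m' = smult (of_nat m) (B ^ (m + m' - 1) * pderiv B)" for m m'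
    by (cases m) (simp_all add: pderiv_power power_add mult_ac del: power_Suc)
  have "wronskian (A ^ i * B ^ k) (A ^ j * B ^ l) =
      (pderiv (A ^ i) * A ^ j - pderiv (A ^ j) * A ^ i) * (B ^ k * B ^ l) +
      (pderiv (B ^ k) * B ^ l - pderiv (B ^ l) * B ^ k) * (A ^ i * A ^ j)"
    by (simp add: wronskian_def pderiv_mult algebra_simps)
  also have "\<dots> = smult (of_nat i - of_nat j) (A ^ r * pderiv A) * (B * B ^ t) +
      smult (of_nat k - of_nat l) (B ^ t * pderiv B) * (A * A ^ r)"
    by (simp add: dA dB rt r_def t_def add.commute smult_diff_left)
  also have "of_nat k - of_nat l = - (of_nat i - of_nat j :: 'a)"
  proof -
    have "(of_nat i + of_nat k :: 'a) = of_nat j + of_nat l"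
      using arg_cong[OF assms, of of_nat] by simp
    thus ?thesis by (simp add: algebra_simps)
  qed
  finally show ?thesis
    by (simp add: wronskian_def r_def t_def algebra_simps smult_diff_left smult_diff_right smult_add_right)
qed

section \<open>Rational functions in lowest terms\<close>

lemma infinite_UNIV_alg_closed: "infinite (UNIV :: 'a::alg_closed_field set)"
proof
  assume fin: "finite (UNIV :: 'a set)"
  define p where "p = (\<Prod>a\<in>(UNIV :: 'a set). [:-a, 1:]) + 1"
  have "\<not> is_unit (\<Prod>a\<in>(UNIV :: 'a set). [:-a, 1:])"
  proof
    assume "is_unit (\<Prod>a\<in>(UNIV :: 'a set). [:-a, 1:])"
    hence "is_unit [:-0, 1::'a:]" using fin by (meson UNIV_I dvd_prodI dvd_trans)
    thus False by (simp add: is_unit_iff_degree)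
  qed
  moreover have nz: "(\<Prod>a\<in>(UNIV :: 'a set). [:-a, 1:]) \<noteq> 0" using fin by simp
  ultimately have "degree (\<Prod>a\<in>(UNIV :: 'a set). [:-a, 1:]) > 0" by (simp add: is_unit_iff_degree)
  hence "degree p > 0" unfolding p_def by (subst degree_add_eq_left) simp_all
  then obtain x where "poly p x = 0" using alg_closed_imp_poly_has_root by blast
  moreover have "(\<Prod>a\<in>UNIV. x - a) = 0" using fin by (intro prod_zero) auto
  ultimately show False by (simp add: p_def poly_prod)
qed

lemma poly_eqI_off_0:
  fixes p q :: "'a::alg_closed_field poly"
  assumes "\<And>z. z \<noteq> 0 \<Longrightarrow> poly p z = poly q z"
  shows "p = q"
proof (rule ccontr)
  assume "p \<noteq> q"
  hence "finite {z. poly (p - q) z = 0}" by (intro poly_roots_finite) simp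
  moreover have "- {0} \<subseteq> {z. poly (p - q) z = 0}" using assms by auto
  ultimately have "finite (- {0} :: 'a set)" by (metis finite_subset)
  thus False using infinite_UNIV_alg_closed[where ?'a = 'a] by (simp add: finite_compl)
qed

lemma coprime_imp_no_common_root:
  fixes A B :: "'a::field poly"
  assumes "Rings.coprime A B"
  shows "poly A z \<noteq> 0 \<or> poly B z \<noteq> 0"
proof (rule ccontr)
  assume "\<not> ?thesis"
  hence "[:-z, 1:] dvd A" "[:-z, 1:] dvd B" by (simp_all add: poly_eq_0_iff_dvd)
  hence "is_unit [:-z, 1:]" by (rule Rings.coprime_common_divisor[OF assms])
  thus False by (simp add: is_unit_iff_degree)
qed

text \<open>Over an algebraically closed field divisibility compares orders root by root, and at a
  root of \<open>B\<close> the factor \<open>A\<close> has order 0.\<close>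

lemma dvd_cancel_no_common_root:
  fixes A B D :: "'a::alg_closed_field poly"
  assumes "B dvd A * D" "B \<noteq> 0" "\<And>z. poly A z \<noteq> 0 \<or> poly B z \<noteq> 0"
  shows "B dvd D"
proof (cases "D = 0")
  case False
  have "proots B \<subseteq># proots D"
  proof (rule mset_subset_eqI)
    fix z
    show "count (proots B) z \<le> count (proots D) z"
    proof (cases "poly B z = 0")
      case True
      hence Az: "poly A z \<noteq> 0" using assms(3) by blast
      hence nz: "A * D \<noteq> 0" using False by auto
      have "Polynomial.order z B \<le> Polynomial.order z (A * D)"
        using assms(1) nz by (rule dvd_imp_order_le[rotated])
      also have "\<dots> = Polynomial.order z D"
        using nz order_0I[OF Az] by (simp add: order_mult)
      finally show ?thesis using assms(2) False by simp
    qed (simp add: assms(2) order_0I)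
  qed
  hence "(\<Prod>x\<in>#proots B. [:-x, 1:]) dvd (\<Prod>x\<in>#proots D. [:-x, 1:])"
    by (intro prod_mset_subset_imp_dvd image_mset_subseteq_mono)
  hence "smult (lead_coeff B) (\<Prod>x\<in>#proots B. [:-x, 1:]) dvd
      smult (lead_coeff D) (\<Prod>x\<in>#proots D. [:-x, 1:])"
    using assms(2) by (simp add: smult_dvd_iff dvd_smult)
  thus ?thesis unfolding poly_splits_proots[symmetric] .
qed simp

text \<open>\<open>rat_quot\<close> is a choice, but fractions in lowest terms agree up to a
  constant; so any explicit fraction without common roots can be used for computing.\<close>

lemma rat_quot_Fract:
  fixes A B :: "'a::alg_closed_field poly"
  assumes B: "B \<noteq> 0" and cop: "\<And>z. poly A z \<noteq> 0 \<or> poly B z \<noteq> 0"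
  obtains c where "c \<noteq> 0" "rat_quot (Fraction_Field.Fract A B) = (smult c A, smult c B)"
proof -
  obtain C D where CD: "rat_quot (Fraction_Field.Fract A B) = (C, D)" by fastforce
  have "lowest_terms (Fraction_Field.Fract A B) (C, D)"
    using lowest_terms_rat_quot[of "Fraction_Field.Fract A B"] CD by simp
  hence D: "D \<noteq> 0" "Rings.coprime C D" "Fraction_Field.Fract A B = Fraction_Field.Fract C D"
    by (simp_all add: lowest_terms_def)
  hence eq: "A * D = C * B" using B by (simp add: eq_fract)
  have "B dvd A * D" unfolding eq by simp
  hence "B dvd D" by (rule dvd_cancel_no_common_root[OF _ B cop])
  moreover have "D dvd C * B" unfolding eq[symmetric] by simp
  hence "D dvd B"
    by (rule dvd_cancel_no_common_root[OF _ D(1) coprime_imp_no_common_root[OF D(2)]])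
  ultimately obtain u u' where u: "D = B * u" and u': "B = D * u'" by (elim dvdE)
  have "u \<noteq> 0" using D(1) u by (metis mult_zero_right)
  moreover have "u' \<noteq> 0" using B u' by (metis mult_zero_right)
  ultimately have "degree u = 0"
    using degree_mult_eq[of B u] degree_mult_eq[of D u'] B D(1)
    unfolding u[symmetric] u'[symmetric] by linarith
  obtain c where c: "u = [:c:]" using \<open>degree u = 0\<close> by (rule degree_eq_zeroE)
  have "c \<noteq> 0" using \<open>u \<noteq> 0\<close> c by auto
  moreover have Dc: "D = smult c B" using u c by simp
  moreover have "B * smult c A = B * C" using eq Dc by (simp add: mult.commute)
  hence "C = smult c A" unfolding mult_left_cancel[OF B] ..
  ultimately show ?thesis using that CD by simp
qed

lemma rat_deriv_at_Fract:
  fixes A B :: "'a::alg_closed_field poly"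
  assumes "B \<noteq> 0" "\<And>z. poly A z \<noteq> 0 \<or> poly B z \<noteq> 0"
  shows "rat_deriv_at (Fraction_Field.Fract A B) a = poly (wronskian A B) a / (poly B a)\<^sup>2"
proof -
  obtain c where c: "c \<noteq> 0" "rat_quot (Fraction_Field.Fract A B) = (smult c A, smult c B)"
    by (rule rat_quot_Fract[OF assms])
  have "c * c * (x - y) / (c * b)\<^sup>2 = (x - y) / b\<^sup>2" for x y b :: 'a
    using c(1) by (simp add: power2_eq_square)
  from this[of "poly (pderiv A) a * poly B a" "poly A a * poly (pderiv B) a" "poly B a"] show ?thesis
    by (simp add: rat_deriv_at_def c wronskian_def pderiv_smult algebra_simps)
qed

lemma rat_comp_Fract:
  fixes A B :: "'a::alg_closed_field poly"
  assumes PQ: "rat_quot \<phi> = (P, Q)" "degree P \<le> d" "degree Q \<le> d"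
    and B: "B \<noteq> 0" and nz: "homog_subst d Q A B \<noteq> 0"
  shows "rat_comp \<phi> (Fraction_Field.Fract A B) =
           Fraction_Field.Fract (homog_subst d P A B) (homog_subst d Q A B)"
proof -
  let ?\<psi> = "Fraction_Field.Fract A B"
  have \<psi>: "?\<psi> = to_fract A / to_fract B" by (rule Fract_conv_to_fract)
  have key: "poly (map_poly (\<lambda>c. to_fract [:c:]) p) ?\<psi> * to_fract B ^ d = to_fract (homog_subst d p A B)"
    if "degree p \<le> d" for p
  proof -
    have tf_sum: "to_fract (\<Sum>i\<in>I. f i) = (\<Sum>i\<in>I. to_fract (f i))" for I :: "nat set" and f :: "nat \<Rightarrow> 'a poly"
      by (induction I rule: infinite_finite_induct) auto
    have tf_pow: "to_fract (x ^ k) = to_fract x ^ k" for x :: "'a poly" and k by (induction k) auto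
    have deg: "degree (map_poly (\<lambda>c. to_fract [:c:]) p) \<le> d"
      using that by (intro degree_le) (auto simp: coeff_map_poly coeff_eq_0)
    have "to_fract [:coeff p i:] * ?\<psi> ^ i * to_fract B ^ d =
        to_fract (smult (coeff p i) (A ^ i * B ^ (d - i)))" if "i \<le> d" for i
    proof -
      have "?\<psi> ^ i * to_fract B ^ d = to_fract (A ^ i) * to_fract (B ^ (d - i))"
      proof -
        have "to_fract B ^ d = to_fract B ^ i * to_fract B ^ (d - i)"
          using that by (simp flip: power_add)
        thus ?thesis using B by (simp add: \<psi> power_divide tf_pow)
      qed
      moreover have "smult (coeff p i) (A ^ i * B ^ (d - i)) = [:coeff p i:] * (A ^ i * B ^ (d - i))"
        by simp
      ultimately show ?thesis by (simp only: to_fract_mult mult.assoc)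
    qed
    thus ?thesis
      by (simp add: poly_altdef_le[OF deg] homog_subst_def tf_sum sum_distrib_right coeff_map_poly)
  qed
  have "to_fract B ^ d \<noteq> 0" using B by simp
  thus ?thesis
    unfolding rat_comp_def PQ(1) prod.case Fract_conv_to_fract[of "homog_subst d P A B"]
      key[OF PQ(2), symmetric] key[OF PQ(3), symmetric]
    by simp
qed

section \<open>Lifting to the plane\<close>

definition cross :: "'a::comm_ring \<times> 'a \<Rightarrow> 'a \<times> 'a \<Rightarrow> 'a" where
  "cross v w = fst v * snd w - snd v * fst w"

definition proj_point :: "'a::field \<times> 'a \<Rightarrow> 'a proj_line" where
  "proj_point v = (if snd v = 0 then Infty else Fin (fst v / snd v))"

lemma proj_point_eq_iff:
  assumes "v \<noteq> 0" "w \<noteq> 0"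
  shows "proj_point v = proj_point w \<longleftrightarrow> cross v w = 0"
  using assms by (cases v; cases w) (auto simp: proj_point_def cross_def zero_prod_def field_simps)

lemma proj_point_scale: "c \<noteq> 0 \<Longrightarrow> proj_point (c * fst v, c * snd v) = proj_point v"
  by (simp add: proj_point_def)

lemma proj_point_surj: "\<exists>v. v \<noteq> 0 \<and> proj_point v = x"
proof (cases x)
  case (Fin a)
  show ?thesis by (rule exI[of _ "(a, 1)"]) (simp add: Fin proj_point_def zero_prod_def)
next
  case Infty
  show ?thesis by (rule exI[of _ "(1, 0)"]) (simp add: Infty proj_point_def zero_prod_def)
qed

lemma cross_scale_right: "cross w (c * fst v, c * snd v) = c * cross w v"
  by (simp add: cross_def algebra_simps)

text \<open>The coordinate on the projective line that is 0 at \<open>v\<close> and infinity at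
  \<open>w\<close>, as a pair of polynomials of degree at most 1.\<close>

definition line_pair :: "'a::comm_semiring_1 \<times> 'a \<Rightarrow> 'a \<times> 'a \<Rightarrow> 'a poly \<times> 'a poly" where
  "line_pair v w = ([:fst v, fst w:], [:snd v, snd w:])"

definition eval_pair :: "'a::comm_semiring_0 poly \<times> 'a poly \<Rightarrow> 'a \<Rightarrow> 'a \<times> 'a" where
  "eval_pair AB z = (poly (fst AB) z, poly (snd AB) z)"

lemma eval_line_pair: "eval_pair (line_pair v w) z = (fst v + z * fst w, snd v + z * snd w)"
  by (simp add: eval_pair_def line_pair_def)

lemma wronskian_line_pair:
  "wronskian (fst (line_pair v w)) (snd (line_pair v w)) = [:- cross v w:]"
  by (simp add: wronskian_def line_pair_def pderiv_pCons cross_def algebra_simps)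

lemma line_nonzero:
  assumes "cross v w \<noteq> (0 :: 'a::field)"
  shows "(fst v + z * fst w, snd v + z * snd w) \<noteq> 0"
proof
  assume "(fst v + z * fst w, snd v + z * snd w) = 0"
  hence "fst v = - z * fst w" "snd v = - z * snd w"
    by (simp_all add: zero_prod_def eq_neg_iff_add_eq_0)
  thus False using assms by (simp add: cross_def)
qed

lemma exists_cross_nonzero:
  fixes v :: "'a::field \<times> 'a"
  assumes "v \<noteq> 0"
  shows "\<exists>w. cross v w \<noteq> 0"
proof (cases "fst v = 0")
  case True
  hence "cross v (1, 0) \<noteq> 0" using assms by (cases v) (auto simp: cross_def zero_prod_def)
  thus ?thesis by blast
next
  case False
  hence "cross v (0, 1) \<noteq> 0" by (simp add: cross_def)
  thus ?thesis by blast
qed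

lemma cross_basis:
  fixes v w u :: "'a::field \<times> 'a"
  assumes "cross v w \<noteq> 0"
  obtains a b where "u = (a * fst v + b * fst w, a * snd v + b * snd w)"
proof
  have "cross u w * fst v + cross v u * fst w = fst u * cross v w"
    "cross u w * snd v + cross v u * snd w = snd u * cross v w"
    by (simp_all add: cross_def algebra_simps)
  thus "u = ((cross u w / cross v w) * fst v + (cross v u / cross v w) * fst w,
             (cross u w / cross v w) * snd v + (cross v u / cross v w) * snd w)"
    using assms by (simp add: prod_eq_iff flip: add_divide_distrib)
qed

section \<open>The homogeneous lift of a rational map\<close>

locale rational_map =
  fixes \<phi> :: "'a::alg_closed_field poly fract" and P Q :: "'a poly" and d :: nat
  assumes quot: "rat_quot \<phi> = (P, Q)"
    and d_eq: "d = max (degree P) (degree Q)"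
    and d_ge_2: "d \<ge> 2"
begin

lemma Q_nonzero: "Q \<noteq> 0" and \<phi>_eq: "\<phi> = Fraction_Field.Fract P Q"
  and no_common_root: "poly P z \<noteq> 0 \<or> poly Q z \<noteq> 0"
  using lowest_terms_rat_quot[of \<phi>] coprime_imp_no_common_root[of P Q z]
  by (simp_all add: quot lowest_terms_def)

lemma deg_le: "degree P \<le> d" "degree Q \<le> d"
  by (simp_all add: d_eq)

lemma top_coeff: "coeff P d \<noteq> 0 \<or> coeff Q d \<noteq> 0"
  using d_eq d_ge_2 by (cases "degree P \<le> degree Q") (auto simp: max_def)

definition lift :: "'a \<times> 'a \<Rightarrow> 'a \<times> 'a" where
  "lift v = (homog_eval d P (fst v) (snd v), homog_eval d Q (fst v) (snd v))"

definition lift_poly :: "'a poly \<times> 'a poly \<Rightarrow> 'a poly \<times> 'a poly" where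
  "lift_poly AB = (homog_subst d P (fst AB) (snd AB), homog_subst d Q (fst AB) (snd AB))"

text \<open>The exponents are truncated only for \<open>i = j = 0\<close> and
  \<open>i = j = d\<close>, where the factor \<open>i - j\<close> vanishes.\<close>

definition jac :: "'a \<times> 'a \<Rightarrow> 'a" where
  "jac v = (\<Sum>i\<le>d. \<Sum>j\<le>d. coeff P i * coeff Q j * (of_nat i - of_nat j) *
              (fst v ^ (i + j - 1) * snd v ^ (2 * d - i - j - 1)))"

lemma fst_lift_poly: "fst (lift_poly AB) = homog_subst d P (fst AB) (snd AB)"
  and snd_lift_poly: "snd (lift_poly AB) = homog_subst d Q (fst AB) (snd AB)"
  by (simp_all add: lift_poly_def)

lemma lift_nonzero: "v \<noteq> 0 \<Longrightarrow> lift v \<noteq> 0"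
proof (cases "snd v = 0")
  case True
  assume "v \<noteq> 0"
  hence "fst v \<noteq> 0" using True by (cases v) (auto simp: zero_prod_def)
  thus ?thesis using True top_coeff by (auto simp: lift_def zero_prod_def homog_eval_0_right)
next
  case False
  thus ?thesis using no_common_root[of "fst v / snd v"]
    by (auto simp: lift_def zero_prod_def homog_eval_dehomogenize deg_le)
qed

lemma lift_scale: "lift (c * fst v, c * snd v) = (c ^ d * fst (lift v), c ^ d * snd (lift v))"
  by (simp add: lift_def homog_eval_scale)

lemma lift_iter_nonzero: "v \<noteq> 0 \<Longrightarrow> (lift ^^ n) v \<noteq> 0"
  by (induction n) (simp_all add: lift_nonzero)

lemma lift_iter_scale:
  "(lift ^^ n) (c * fst v, c * snd v) =
     (c ^ (d ^ n) * fst ((lift ^^ n) v), c ^ (d ^ n) * snd ((lift ^^ n) v))"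
proof (induction n)
  case (Suc n)
  thus ?case using lift_scale[of "c ^ (d ^ n)" "(lift ^^ n) v"] by (simp flip: power_mult add: mult.commute)
qed simp

lemma rat_eval_proj_point: "v \<noteq> 0 \<Longrightarrow> rat_eval \<phi> (proj_point v) = proj_point (lift v)"
proof (cases "snd v = 0")
  case True
  assume "v \<noteq> 0"
  hence u: "fst v \<noteq> 0" using True by (cases v) (auto simp: zero_prod_def)
  have l: "lift v = (coeff P d * fst v ^ d, coeff Q d * fst v ^ d)"
    by (simp add: lift_def True homog_eval_0_right)
  show ?thesis
  proof (cases "degree Q < degree P")
    case True2: True
    hence "coeff Q d = 0" by (simp add: d_eq coeff_eq_0)
    thus ?thesis using True True2 l by (simp add: proj_point_def quot)
  next
    case False
    hence "d = degree Q" by (simp add: d_eq)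
    thus ?thesis using True False l u Q_nonzero by (simp add: proj_point_def quot)
  qed
next
  case False
  thus ?thesis
    by (simp add: proj_point_def quot lift_def homog_eval_dehomogenize deg_le)
qed

lemma rat_eval_iter_proj_point:
  "v \<noteq> 0 \<Longrightarrow> (rat_eval \<phi> ^^ n) (proj_point v) = proj_point ((lift ^^ n) v)"
  by (induction n) (auto simp: rat_eval_proj_point lift_iter_nonzero)

lemma eval_lift_poly: "eval_pair (lift_poly AB) z = lift (eval_pair AB z)"
  by (simp add: eval_pair_def lift_poly_def lift_def poly_homog_subst)

lemma eval_lift_poly_iter: "eval_pair ((lift_poly ^^ n) AB) z = (lift ^^ n) (eval_pair AB z)"
  by (induction n) (simp_all add: eval_lift_poly)

lemma lift_poly_top:
  assumes "degree (fst AB) \<le> e" "degree (snd AB) \<le> e"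
  shows "degree (fst (lift_poly AB)) \<le> d * e" "degree (snd (lift_poly AB)) \<le> d * e"
    "(coeff (fst (lift_poly AB)) (d * e), coeff (snd (lift_poly AB)) (d * e)) =
       lift (coeff (fst AB) e, coeff (snd AB) e)"
  using homog_subst_top[OF assms] by (simp_all add: lift_poly_def lift_def)

lemma lift_poly_iter_top:
  assumes "AB = line_pair v w"
  shows "degree (fst ((lift_poly ^^ n) AB)) \<le> d ^ n \<and> degree (snd ((lift_poly ^^ n) AB)) \<le> d ^ n \<and>
     (coeff (fst ((lift_poly ^^ n) AB)) (d ^ n), coeff (snd ((lift_poly ^^ n) AB)) (d ^ n)) = (lift ^^ n) w"
proof (induction n)
  case 0
  show ?case by (simp add: assms line_pair_def)
next
  case (Suc n)
  thus ?case
    using lift_poly_top[of "(lift_poly ^^ n) AB" "d ^ n"] by simp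
qed

text \<open>By bilinearity the Wronskian of \<open>lift_poly (A, B)\<close> reduces to Wronskians of monomials in
  \<open>A\<close> and \<open>B\<close>, each a multiple of the Wronskian of \<open>A\<close> and \<open>B\<close>: this is the chain rule, with
  \<open>jac\<close> the Jacobian determinant of \<open>lift\<close> divided by \<open>d\<close>.\<close>

lemma wronskian_lift_poly:
  "poly (wronskian (fst (lift_poly AB)) (snd (lift_poly AB))) z =
     jac (eval_pair AB z) * poly (wronskian (fst AB) (snd AB)) z"
proof -
  obtain A B where AB: "AB = (A, B)" by fastforce
  have "poly (wronskian (smult (coeff P i) (A ^ i * B ^ (d - i))) (smult (coeff Q j) (A ^ j * B ^ (d - j)))) z =
      coeff P i * coeff Q j * (of_nat i - of_nat j) *
        (poly A z ^ (i + j - 1) * poly B z ^ (2 * d - i - j - 1)) * poly (wronskian A B) z"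
    if "i \<le> d" "j \<le> d" for i j
  proof -
    have "d - i + (d - j) - 1 = 2 * d - i - j - 1" using that by linarith
    thus ?thesis
      using wronskian_monomials[of i "d - i" j "d - j" A B] that
      by (simp add: wronskian_smult mult_ac)
  qed
  thus ?thesis
    by (simp add: AB lift_poly_def homog_subst_def wronskian_sum poly_sum jac_def eval_pair_def sum_distrib_right)
qed

lemma wronskian_lift_poly_iter:
  "poly (wronskian (fst ((lift_poly ^^ n) AB)) (snd ((lift_poly ^^ n) AB))) z =
     (\<Prod>i<n. jac ((lift ^^ i) (eval_pair AB z))) * poly (wronskian (fst AB) (snd AB)) z"
  by (induction n) (simp_all add: wronskian_lift_poly eval_lift_poly_iter)

lemma jac_scale: "jac (c * fst v, c * snd v) = c ^ (2 * d - 2) * jac v"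
proof -
  have "coeff P i * coeff Q j * (of_nat i - of_nat j) *
          ((c * fst v) ^ (i + j - 1) * (c * snd v) ^ (2 * d - i - j - 1)) =
        c ^ (2 * d - 2) * (coeff P i * coeff Q j * (of_nat i - of_nat j) *
          (fst v ^ (i + j - 1) * snd v ^ (2 * d - i - j - 1)))"
    if "i \<le> d" "j \<le> d" for i j
  proof (cases "i = j")
    case False
    hence "(i + j - 1) + (2 * d - i - j - 1) = 2 * d - 2" using that by linarith
    hence "c ^ (2 * d - 2) = c ^ (i + j - 1) * c ^ (2 * d - i - j - 1)" by (metis power_add)
    thus ?thesis by (simp only: power_mult_distrib mult_ac)
  qed simp
  thus ?thesis
    unfolding jac_def sum_distrib_left fst_conv snd_conv by (intro sum.cong refl) auto
qed

section \<open>Preimages, and nonvanishing of the lifted iterates\<close>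

lemma lift_surj:
  assumes "w \<noteq> 0"
  shows "\<exists>v. v \<noteq> 0 \<and> cross w (lift v) = 0"
proof -
  define T where "T = smult (fst w) Q - smult (snd w) P"
  have T1: "cross w (lift (z, 1)) = poly T z" for z
    by (simp add: T_def cross_def lift_def homog_eval_1_right deg_le)
  have T2: "cross w (lift (1, 0)) = coeff T d"
    by (simp add: T_def cross_def lift_def homog_eval_0_right)
  show ?thesis
  \<comment> \<open>The roots of \<open>T\<close> give the finite preimages. If \<open>T\<close> is
    constant, its coefficient in degree \<open>d \<ge> 2\<close> vanishes, and infinity is a
    preimage.\<close>
  proof (cases "degree T = 0")
    case True
    hence "coeff T d = 0" using d_ge_2 by (simp add: coeff_eq_0)
    thus ?thesis using T2 by (intro exI[of _ "(1, 0)"]) (simp add: zero_prod_def)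
  next
    case False
    then obtain z where "poly T z = 0" using alg_closed_imp_poly_has_root[of T] by blast
    thus ?thesis using T1 by (intro exI[of _ "(z, 1)"]) (simp add: zero_prod_def)
  qed
qed

lemma rat_eval_surj: "\<exists>v. v \<noteq> 0 \<and> rat_eval \<phi> (proj_point v) = x"
proof -
  obtain w where w: "w \<noteq> 0" "proj_point w = x" using proj_point_surj by blast
  obtain v where v: "v \<noteq> 0" "cross w (lift v) = 0" using lift_surj[OF w(1)] by blast
  have "proj_point w = proj_point (lift v)"
    using v(2) by (subst proj_point_eq_iff[OF w(1) lift_nonzero[OF v(1)]])
  thus ?thesis using v(1) w(2) rat_eval_proj_point[OF v(1)] by metis
qed

lemma rat_eval_iter_surj: "\<exists>v. v \<noteq> 0 \<and> (rat_eval \<phi> ^^ n) (proj_point v) = x"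
proof (induction n arbitrary: x)
  case 0
  show ?case using proj_point_surj by simp
next
  case (Suc n)
  obtain v where v: "rat_eval \<phi> (proj_point v) = x" using rat_eval_surj by blast
  obtain u where "u \<noteq> 0" "(rat_eval \<phi> ^^ n) (proj_point u) = proj_point v" using Suc by blast
  thus ?case using v by (intro exI[of _ u]) simp
qed

lemma eval_lift_poly_iter_nonzero:
  assumes "cross v w \<noteq> 0"
  shows "poly (fst ((lift_poly ^^ n) (line_pair v w))) z \<noteq> 0 \<or>
         poly (snd ((lift_poly ^^ n) (line_pair v w))) z \<noteq> 0"
  using lift_iter_nonzero[OF line_nonzero[OF assms], of n z]
    eval_lift_poly_iter[of n "line_pair v w" z]
  by (auto simp: eval_pair_def eval_line_pair[unfolded eval_pair_def] zero_prod_def prod_eq_iff)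

text \<open>If this polynomial vanished, the iterate would send the whole projective line to the
  point of \<open>x\<close>, contradicting surjectivity.\<close>

lemma lift_poly_iter_cross_nonzero:
  assumes "cross v w \<noteq> 0" "x \<noteq> 0"
  shows "smult (fst x) (snd ((lift_poly ^^ n) (line_pair v w))) -
         smult (snd x) (fst ((lift_poly ^^ n) (line_pair v w))) \<noteq> 0" (is "?T \<noteq> 0")
proof
  assume T: "?T = 0"
  have "\<exists>y. y \<noteq> 0 \<and> proj_point y \<noteq> proj_point x"
  proof (cases "snd x = 0")
    case True
    thus ?thesis by (intro exI[of _ "(0, 1)"]) (simp add: proj_point_def zero_prod_def)
  next
    case False
    thus ?thesis by (intro exI[of _ "(1, 0)"]) (simp add: proj_point_def zero_prod_def)
  qed
  then obtain y where y: "y \<noteq> 0" "proj_point y \<noteq> proj_point x" by blast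
  obtain u where u: "u \<noteq> 0" "(rat_eval \<phi> ^^ n) (proj_point u) = proj_point y"
    using rat_eval_iter_surj by blast
  obtain a b where ab: "u = (a * fst v + b * fst w, a * snd v + b * snd w)"
    using cross_basis[OF assms(1)] by blast
  have "cross x ((lift ^^ n) u) = 0"
  \<comment> \<open>For \<open>a = 0\<close> the point is \<open>w\<close>, the infinity of the
    line, where the image is read off the formal top coefficients.\<close>
  proof (cases "a = 0")
    case True
    have "cross x ((lift ^^ n) w) = coeff ?T (d ^ n)"
      using lift_poly_iter_top[of "line_pair v w" v w n] by (simp add: cross_def prod_eq_iff)
    moreover have "(lift ^^ n) u = (b ^ d ^ n * fst ((lift ^^ n) w), b ^ d ^ n * snd ((lift ^^ n) w))"
      using ab True lift_iter_scale[of n b w] by simp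
    ultimately show ?thesis using T by (simp add: cross_scale_right)
  next
    case False
    let ?u = "(fst v + b / a * fst w, snd v + b / a * snd w)"
    have "cross x ((lift ^^ n) ?u) = poly ?T (b / a)"
      using eval_lift_poly_iter[of n "line_pair v w" "b / a"]
      by (simp add: cross_def eval_line_pair) (simp add: eval_pair_def prod_eq_iff)
    moreover have "u = (a * fst ?u, a * snd ?u)" using ab False by (simp add: field_simps)
    hence "(lift ^^ n) u = (a ^ d ^ n * fst ((lift ^^ n) ?u), a ^ d ^ n * snd ((lift ^^ n) ?u))"
      using lift_iter_scale[of n a ?u] by simp
    ultimately show ?thesis using T by (simp add: cross_scale_right)
  qed
  hence "proj_point x = proj_point ((lift ^^ n) u)"
    using assms(2) lift_iter_nonzero[OF u(1)] by (simp add: proj_point_eq_iff)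
  thus False using u y by (simp add: rat_eval_iter_proj_point)
qed

lemma lift_poly_iter_nonzero:
  assumes "cross v w \<noteq> 0"
  shows "fst ((lift_poly ^^ n) (line_pair v w)) \<noteq> 0" "snd ((lift_poly ^^ n) (line_pair v w)) \<noteq> 0"
  using lift_poly_iter_cross_nonzero[OF assms, of "(0, 1)" n]
    lift_poly_iter_cross_nonzero[OF assms, of "(1, 0)" n]
  by (simp_all add: zero_prod_def)

lemma rat_comp_iter_line_pair:
  assumes "cross v w \<noteq> 0"
  shows "(rat_comp \<phi> ^^ n) (Fraction_Field.Fract (fst (line_pair v w)) (snd (line_pair v w))) =
     Fraction_Field.Fract (fst ((lift_poly ^^ n) (line_pair v w))) (snd ((lift_poly ^^ n) (line_pair v w)))"
proof (induction n)
  case (Suc n)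
  have "homog_subst d Q (fst ((lift_poly ^^ n) (line_pair v w))) (snd ((lift_poly ^^ n) (line_pair v w))) \<noteq> 0"
    using lift_poly_iter_nonzero(2)[OF assms, of "Suc n"] by (simp add: snd_lift_poly)
  from rat_comp_Fract[OF quot deg_le lift_poly_iter_nonzero(2)[OF assms] this] Suc
  show ?case by (simp add: fst_lift_poly snd_lift_poly)
qed simp

text \<open>Along a line through \<open>v\<close>, the cross product with \<open>lift v\<close> is a form of degree \<open>d \<ge> 2\<close>
  whose root at \<open>v\<close> is simple, so it has another root.\<close>

lemma exists_other_preimage:
  assumes v: "v \<noteq> 0" and j: "jac v \<noteq> 0"
  shows "\<exists>b. cross v b \<noteq> 0 \<and> cross (lift v) (lift b) = 0"
proof -
  obtain w where w: "cross v w \<noteq> 0" using exists_cross_nonzero[OF v] by blast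
  let ?L = "line_pair v w"
  define A where "A = fst (lift_poly ?L)"
  define B where "B = snd (lift_poly ?L)"
  define p where "p = smult (fst (lift v)) B - smult (snd (lift v)) A"
  have AB: "eval_pair (A, B) z = lift (fst v + z * fst w, snd v + z * snd w)" for z
    using eval_lift_poly[of ?L z] by (simp add: A_def B_def eval_line_pair)
  have pz: "poly p z = cross (lift v) (lift (fst v + z * fst w, snd v + z * snd w))" for z
    unfolding AB[symmetric] by (simp add: p_def cross_def eval_pair_def)
  have top: "degree A \<le> d" "degree B \<le> d" "(coeff A d, coeff B d) = lift w"
    using lift_poly_iter_top[of ?L v w 1] by (simp_all add: A_def B_def)
  have degp: "degree p \<le> d"
    unfolding p_def using top by (intro degree_diff_le order_trans[OF degree_smult_le])
  have ctop: "coeff p d = cross (lift v) (lift w)"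
    unfolding top(3)[symmetric] by (simp add: p_def cross_def)
  have p0: "poly p 0 = 0" unfolding pz by (simp add: cross_def)
  have "(poly A 0, poly B 0) = lift v" using AB[of 0] by (simp add: eval_pair_def)
  hence "poly (pderiv p) 0 = - poly (wronskian A B) 0"
    by (auto simp: p_def pderiv_diff pderiv_smult wronskian_def prod_eq_iff)
  also have "\<dots> = jac v * cross v w"
    using wronskian_lift_poly[of ?L 0]
    by (simp add: A_def B_def wronskian_line_pair eval_line_pair)
  finally have dp: "poly (pderiv p) 0 \<noteq> 0" using j w by simp
  show ?thesis
  \<comment> \<open>A drop of the formal degree means that the second root is
    \<open>w\<close>.\<close>
  proof (cases "coeff p d = 0")
    case True
    thus ?thesis using ctop w by (intro exI[of _ w]) simp
  next
    case False
    hence "degree p = d" using degp by (intro antisym le_degree) auto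
    obtain p1 where p1: "p = [:0, 1:] * p1" using p0 unfolding poly_eq_0_iff_dvd by auto
    have dp1: "poly p1 0 \<noteq> 0" using dp unfolding p1 by (simp add: pderiv_mult pderiv_pCons)
    hence "p1 \<noteq> 0" by auto
    hence "degree p1 > 0" using \<open>degree p = d\<close> d_ge_2 unfolding p1 by (simp add: degree_mult_eq)
    then obtain z where z: "poly p1 z = 0" using alg_closed_imp_poly_has_root by blast
    have "z \<noteq> 0" using z dp1 by auto
    let ?b = "(fst v + z * fst w, snd v + z * snd w)"
    have "cross v ?b = z * cross v w" by (simp add: cross_def algebra_simps)
    moreover have "cross (lift v) (lift ?b) = 0" unfolding pz[symmetric] p1 by (simp add: z)
    ultimately show ?thesis using \<open>z \<noteq> 0\<close> w by (intro exI[of _ ?b]) simp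
  qed
qed

end

section \<open>Multipliers and critical points\<close>

lemma rat_var_eq_line:
  fixes c :: "'a::field"
  assumes "c \<noteq> 0"
  shows "rat_var = Fraction_Field.Fract (fst (line_pair (0, c) (c, 0))) (snd (line_pair (0, c) (c, 0)))"
    and "inverse rat_var = Fraction_Field.Fract (fst (line_pair (c, 0) (0, c))) (snd (line_pair (c, 0) (0, c)))"
  using assms by (simp_all add: rat_var_def to_fract_def line_pair_def eq_fract)

context rational_map
begin

text \<open>Substituting \<open>1 / z\<close> into the iterate amounts to starting the iteration in
  the chart at infinity: homogeneity of degree \<open>d ^ n\<close> gives this at every nonzero
  \<open>z\<close>, which determines the polynomials.\<close>

lemma rat_comp_iter_at_infinity:
  assumes c: "c \<noteq> 0"
  shows "rat_comp (rat_iter \<phi> n) (inverse rat_var) =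
     Fraction_Field.Fract (fst ((lift_poly ^^ n) (line_pair (c, 0) (0, c))))
       (snd ((lift_poly ^^ n) (line_pair (c, 0) (0, c))))"
proof -
  let ?L = "line_pair (0, c) (c, 0)" and ?M = "line_pair (c, 0) (0, c)"
  have cr: "cross (0, c) (c, 0) \<noteq> 0" "cross (c, 0) (0, c) \<noteq> 0" using c by (simp_all add: cross_def)
  define A where "A = fst ((lift_poly ^^ n) ?L)"
  define B where "B = snd ((lift_poly ^^ n) ?L)"
  define A' where "A' = fst ((lift_poly ^^ n) ?M)"
  define B' where "B' = snd ((lift_poly ^^ n) ?M)"
  have B0: "B \<noteq> 0" "B' \<noteq> 0"
    using lift_poly_iter_nonzero[OF cr(1)] lift_poly_iter_nonzero[OF cr(2)] by (simp_all add: B_def B'_def)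
  have iter: "rat_iter \<phi> n = Fraction_Field.Fract A B"
    using rat_comp_iter_line_pair[OF cr(1)] rat_var_eq_line(1)[OF c] by (simp add: rat_iter_def A_def B_def)
  obtain k where k: "k \<noteq> 0" "rat_quot (rat_iter \<phi> n) = (smult k A, smult k B)"
    using rat_quot_Fract[OF B0(1), of A] eval_lift_poly_iter_nonzero[OF cr(1), of n]
    unfolding iter A_def B_def by blast
  have deg: "degree A \<le> d ^ n" "degree B \<le> d ^ n"
    using lift_poly_iter_top[of ?L "(0, c)" "(c, 0)" n] by (simp_all add: A_def B_def)
  have ev: "z ^ (d ^ n) * poly A (1 / z) = poly A' z \<and> z ^ (d ^ n) * poly B (1 / z) = poly B' z"
    if z: "z \<noteq> 0" for z
  proof -
    have "(poly A (1 / z), poly B (1 / z)) = (lift ^^ n) (c / z, c)"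
      using eval_lift_poly_iter[of n ?L "1 / z"]
      by (simp add: eval_line_pair) (simp add: eval_pair_def A_def B_def)
    moreover have "(poly A' z, poly B' z) = (lift ^^ n) (z * (c / z), z * c)"
      using eval_lift_poly_iter[of n ?M z] z
      by (simp add: eval_line_pair) (simp add: eval_pair_def A'_def B'_def)
    ultimately show ?thesis
      using lift_iter_scale[of n z "(c / z, c)"] by (simp add: prod_eq_iff)
  qed
  have hs: "homog_subst (d ^ n) (smult k p) [:1:] [:0, 1:] = smult k p'"
    if "degree p \<le> d ^ n" "\<And>z. z \<noteq> 0 \<Longrightarrow> z ^ (d ^ n) * poly p (1 / z) = poly p' z" for p p'
  proof (rule poly_eqI_off_0)
    fix z :: 'a assume z: "z \<noteq> 0"
    have "degree (smult k p) \<le> d ^ n" using that(1) k by simp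
    from homog_eval_dehomogenize[OF this z, of 1]
    show "poly (homog_subst (d ^ n) (smult k p) [:1:] [:0, 1:]) z = poly (smult k p') z"
      using that(2)[OF z] by (simp add: poly_homog_subst mult.left_commute)
  qed
  have "inverse rat_var = Fraction_Field.Fract [:1:] [:0, 1 :: 'a:]"
    using rat_var_eq_line(2)[of "1 :: 'a"] by (simp add: line_pair_def)
  moreover have "rat_comp (rat_iter \<phi> n) (Fraction_Field.Fract [:1:] [:0, 1:]) =
      Fraction_Field.Fract (smult k A') (smult k B')"
    using rat_comp_Fract[OF k(2), of "d ^ n" "[:0, 1:]" "[:1:]"] deg k(1) B0
      hs[OF deg(1), of A'] hs[OF deg(2), of B'] ev by simp
  ultimately show ?thesis
    using k(1) B0 by (simp add: eq_fract flip: A'_def B'_def)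
qed

text \<open>The coordinate is written as \<open>[c z : c]\<close> (or \<open>[c : c z]\<close> at \<open>\<infinity>\<close>) with \<open>c\<close> a coordinate of
  \<open>v\<close>, so that the line passes through the fixed vector \<open>v\<close> itself and no scaling factor
  appears.\<close>

lemma multiplier_eq:
  assumes v: "v \<noteq> 0" and per: "(lift ^^ n) v = v"
  shows "multiplier \<phi> n (proj_point v) = (\<Prod>i<n. jac ((lift ^^ i) v))"
proof (cases "snd v = 0")
  case False
  define c where "c = snd v"
  define a where "a = fst v / c"
  have c: "c \<noteq> 0" using False by (simp add: c_def)
  let ?L = "line_pair (0, c) (c, 0)"
  have cr: "cross (0, c) (c, 0) \<noteq> 0" using c by (simp add: cross_def)
  define A where "A = fst ((lift_poly ^^ n) ?L)"
  define B where "B = snd ((lift_poly ^^ n) ?L)"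
  have B0: "B \<noteq> 0" using lift_poly_iter_nonzero[OF cr] by (simp add: B_def)
  have iter: "rat_iter \<phi> n = Fraction_Field.Fract A B"
    using rat_comp_iter_line_pair[OF cr] rat_var_eq_line(1)[OF c] by (simp add: rat_iter_def A_def B_def)
  have ncr: "poly A z \<noteq> 0 \<or> poly B z \<noteq> 0" for z
    using eval_lift_poly_iter_nonzero[OF cr] by (simp add: A_def B_def)
  have La: "eval_pair ?L a = v" using c by (simp add: eval_line_pair a_def c_def)
  have "eval_pair (A, B) a = v"
    using eval_lift_poly_iter[of n ?L a] La per by (simp add: A_def B_def)
  hence Ba: "poly B a = c" by (auto simp: eval_pair_def c_def)
  obtain k where k: "k \<noteq> 0" "rat_quot (rat_iter \<phi> n) = (smult k A, smult k B)"
    using rat_quot_Fract[OF B0 ncr] unfolding iter by blast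
  have "multiplier \<phi> n (proj_point v) = rat_deriv_at (rat_iter \<phi> n) a"
    using False k Ba c by (simp add: multiplier_def local_deriv_def proj_point_def a_def c_def Let_def)
  also have "\<dots> = poly (wronskian A B) a / c\<^sup>2"
    unfolding iter using rat_deriv_at_Fract[OF B0 ncr] Ba by simp
  also have "poly (wronskian A B) a = (\<Prod>i<n. jac ((lift ^^ i) v)) * c\<^sup>2"
    using wronskian_lift_poly_iter[of n ?L a] La
    by (simp add: A_def B_def wronskian_line_pair cross_def power2_eq_square)
  finally show ?thesis using c by simp
next
  case True
  define c where "c = fst v"
  have vc: "v = (c, 0)" using True by (simp add: c_def prod_eq_iff)
  have c: "c \<noteq> 0" using v vc by (auto simp: zero_prod_def)
  let ?L = "line_pair (0, c) (c, 0)" and ?M = "line_pair (c, 0) (0, c)"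
  have cr: "cross (0, c) (c, 0) \<noteq> 0" "cross (c, 0) (0, c) \<noteq> 0" using c by (simp_all add: cross_def)
  define A where "A = fst ((lift_poly ^^ n) ?L)"
  define B where "B = snd ((lift_poly ^^ n) ?L)"
  define A' where "A' = fst ((lift_poly ^^ n) ?M)"
  define B' where "B' = snd ((lift_poly ^^ n) ?M)"
  have nz: "B \<noteq> 0" "A' \<noteq> 0" "B' \<noteq> 0"
    using lift_poly_iter_nonzero[OF cr(1)] lift_poly_iter_nonzero[OF cr(2)]
    by (simp_all add: B_def A'_def B'_def)
  have iter: "rat_iter \<phi> n = Fraction_Field.Fract A B"
    using rat_comp_iter_line_pair[OF cr(1)] rat_var_eq_line(1)[OF c] by (simp add: rat_iter_def A_def B_def)
  obtain k where k: "k \<noteq> 0" "rat_quot (rat_iter \<phi> n) = (smult k A, smult k B)"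
    using rat_quot_Fract[OF nz(1), of A] eval_lift_poly_iter_nonzero[OF cr(1), of n]
    unfolding iter A_def B_def by blast
  have top: "degree A \<le> d ^ n" "degree B \<le> d ^ n" "coeff A (d ^ n) = c" "coeff B (d ^ n) = 0"
    using lift_poly_iter_top[of ?L "(0, c)" "(c, 0)" n] per vc by (auto simp: A_def B_def)
  \<comment> \<open>The formal top coefficients are the coordinates of the image of infinity, which
    is \<open>v = (c, 0)\<close> itself; so \<open>1 / z\<close> is the coordinate in the target
    too.\<close>
  have "degree B < degree A"
  proof -
    have "degree B \<noteq> d ^ n" using top(4) nz(1) by (metis leading_coeff_0_iff)
    moreover have "d ^ n \<le> degree A" using top(3) c by (intro le_degree) simp
    ultimately show ?thesis using top(2) by simp
  qed
  hence "rat_eval (rat_iter \<phi> n) Infty = Infty" using k by simp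
  hence "multiplier \<phi> n (proj_point v) = rat_deriv_at (inverse (Fraction_Field.Fract A' B')) 0"
    using rat_comp_iter_at_infinity[OF c, of n]
    by (simp add: multiplier_def local_deriv_def proj_point_def True Let_def A'_def B'_def)
  also have "\<dots> = poly (wronskian B' A') 0 / (poly A' 0)\<^sup>2"
    using rat_deriv_at_Fract[OF nz(2), of B' 0] eval_lift_poly_iter_nonzero[OF cr(2), of n]
    by (auto simp: A'_def B'_def)
  also have "poly A' 0 = c"
    using eval_lift_poly_iter[of n ?M 0] per vc
    by (simp add: eval_line_pair) (simp add: eval_pair_def A'_def)
  also have "poly (wronskian B' A') 0 = (\<Prod>i<n. jac ((lift ^^ i) v)) * c\<^sup>2"
    unfolding wronskian_swap[of B' A'] using wronskian_lift_poly_iter[of n ?M 0] vc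
    by (simp add: A'_def B'_def wronskian_line_pair eval_line_pair cross_def power2_eq_square)
  finally show ?thesis using c by simp
qed

text \<open>In every chart the Wronskian is the numerator of the derivative, and using
  \<open>1 / z\<close> in the target only changes its sign. So all combinations of coordinates
  follow from one zero of \<open>jac\<close>.\<close>

lemma critical_pointI:
  assumes v: "v \<noteq> 0" and j: "jac v = 0"
  shows "critical_point \<phi> (proj_point v)"
proof -
  have chart: "local_deriv \<phi> x = 0"
    if AB: "A \<noteq> 0" "B \<noteq> 0" "\<And>z. poly A z \<noteq> 0 \<or> poly B z \<noteq> 0" "poly (wronskian A B) a = 0"
      and x: "(case x of Fin _ \<Rightarrow> \<phi> | Infty \<Rightarrow> rat_comp \<phi> (inverse rat_var)) = Fraction_Field.Fract A B"
        "a = (case x of Fin a \<Rightarrow> a | Infty \<Rightarrow> 0)" for A B a x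
  proof -
    have "poly B z \<noteq> 0 \<or> poly A z \<noteq> 0" for z using AB(3)[of z] by blast
    hence "rat_deriv_at (Fraction_Field.Fract B A) a = 0"
      using rat_deriv_at_Fract[OF AB(1)] AB(4) by (simp add: wronskian_swap[of B A])
    moreover have "rat_deriv_at (Fraction_Field.Fract A B) a = 0"
      using rat_deriv_at_Fract[OF AB(2,3)] AB(4) by simp
    ultimately show ?thesis
      unfolding local_deriv_def x(1) x(2)[symmetric] Let_def by (simp split: proj_line.split)
  qed
  show ?thesis
  proof (cases "snd v = 0")
    case False
    define a where "a = fst v / snd v"
    let ?L = "line_pair (0, 1) (1, 0)"
    have cr: "cross (0, 1) (1, 0) \<noteq> (0 :: 'a)" by (simp add: cross_def)
    have "jac (snd v * fst (a, 1), snd v * snd (a, 1)) = 0" using False j by (simp add: a_def)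
    hence ja: "jac (a, 1) = 0" using jac_scale[of "snd v" "(a, 1)"] False by simp
    have L: "lift_poly ?L = (P, Q)"
    proof -
      have "eval_pair (lift_poly ?L) z = eval_pair (P, Q) z" for z
        by (simp add: eval_lift_poly eval_line_pair)
           (simp add: eval_pair_def lift_def homog_eval_1_right deg_le)
      thus ?thesis by (auto simp: eval_pair_def prod_eq_iff intro!: poly_eqI_off_0)
    qed
    have nz: "P \<noteq> 0" "Q \<noteq> 0" using lift_poly_iter_nonzero[OF cr, of 1] L by simp_all
    have "poly (wronskian P Q) a = 0"
      using wronskian_lift_poly[of ?L a] L ja by (simp add: eval_line_pair)
    from chart[OF nz no_common_root this, of "proj_point v"] show ?thesis
      using False \<phi>_eq by (simp add: critical_point_def proj_point_def a_def)
  next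
    case True
    let ?M = "line_pair (1, 0) (0, 1)"
    have cr: "cross (1, 0) (0, 1) \<noteq> (0 :: 'a)" by (simp add: cross_def)
    have f: "fst v \<noteq> 0" using v True by (cases v) (auto simp: zero_prod_def)
    have "jac (fst v * fst (1, 0), fst v * snd (1, 0)) = 0" using True j by (cases v) simp
    hence j1: "jac (1, 0) = 0" using jac_scale[of "fst v" "(1, 0)"] f by simp
    have w: "poly (wronskian (fst (lift_poly ?M)) (snd (lift_poly ?M))) 0 = 0"
      using wronskian_lift_poly[of ?M 0] j1 by (simp add: eval_line_pair)
    have "rat_comp \<phi> (inverse rat_var) = Fraction_Field.Fract (fst (lift_poly ?M)) (snd (lift_poly ?M))"
      using rat_comp_iter_line_pair[OF cr, of 1] rat_var_eq_line(2)[of "1 :: 'a"] by simp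
    with chart[of "fst (lift_poly ?M)" "snd (lift_poly ?M)" 0 Infty]
      lift_poly_iter_nonzero[OF cr, of 1] eval_lift_poly_iter_nonzero[OF cr, of 1] w True
    show ?thesis by (simp add: critical_point_def proj_point_def)
  qed
qed

end

section \<open>Coordinates centred at the cycle\<close>

definition ray :: "'a::comm_semiring_0 \<times> 'a \<Rightarrow> 'a \<times> 'a \<Rightarrow> 'a \<Rightarrow> 'a \<times> 'a" where
  "ray v b z = (fst v + z * fst b, snd v + z * snd b)"

lemma ray_0 [simp]: "ray v b 0 = v"
  by (simp add: ray_def)

lemma ray_nonzero: "cross v b \<noteq> (0 :: 'a::field) \<Longrightarrow> ray v b z \<noteq> 0"
  unfolding ray_def by (rule line_nonzero)

lemma cross_ray_ray: "cross (ray v b z) (ray v b w) = (w - z) * cross v b"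
  by (simp add: ray_def cross_def algebra_simps)

lemma proj_point_ray_inj:
  "cross v b \<noteq> (0 :: 'a::field) \<Longrightarrow> proj_point (ray v b z) = proj_point (ray v b w) \<Longrightarrow> z = w"
  using proj_point_eq_iff[OF ray_nonzero ray_nonzero, of v b v b z w] by (simp add: cross_ray_ray)

lemma cross_eq_0_imp_eq_0:
  fixes u v b :: "'a::field \<times> 'a"
  assumes "cross v b \<noteq> 0" "cross v u = 0" "cross u b = 0"
  shows "u = 0"
proof -
  have "cross u b * fst v + cross v u * fst b = fst u * cross v b"
    "cross u b * snd v + cross v u * snd b = snd u * cross v b"
    by (simp_all add: cross_def algebra_simps)
  thus ?thesis using assms by (simp add: prod_eq_iff)
qed

section \<open>The chordal metric in homogeneous coordinates\<close>

context nonarch_absolute_value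
begin

definition vec_norm :: "'a \<times> 'a \<Rightarrow> real" where
  "vec_norm v = max (av (fst v)) (av (snd v))"

lemma vec_norm_pos: "v \<noteq> 0 \<Longrightarrow> 0 < vec_norm v"
  by (cases v) (auto simp: vec_norm_def zero_prod_def av_pos_iff less_max_iff_disj)

lemma chordal_proj_point:
  assumes "x \<noteq> 0" "y \<noteq> 0"
  shows "chordal av (proj_point x) (proj_point y) = av (cross x y) / (vec_norm x * vec_norm y)"
proof -
  have m: "max 1 (av (u / v)) = vec_norm (u, v) / av v" if "v \<noteq> 0" for u v
    using that nonneg[of u] by (simp add: vec_norm_def av_divide av_pos_iff max_def field_simps eq_0_iff)
  have i: "vec_norm (u, 0) = av u" for u using nonneg[of u] by (simp add: vec_norm_def)
  obtain a b c e where xy: "x = (a, b)" "y = (c, e)" by fastforce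
  have p: "vec_norm (a, b) > 0" "vec_norm (c, e) > 0" using assms vec_norm_pos xy by auto
  consider "b \<noteq> 0" "e \<noteq> 0" | "b \<noteq> 0" "e = 0" | "b = 0" "e \<noteq> 0" | "b = 0" "e = 0" by blast
  thus ?thesis
  proof cases
    case 1
    have "a / b - c / e = cross x y / (b * e)" using 1 by (simp add: xy cross_def field_simps)
    thus ?thesis using 1 p
      by (simp add: xy proj_point_def m) (simp add: av_divide mult av_pos_iff field_simps eq_0_iff)
  next
    case 2
    thus ?thesis using p by (simp add: xy proj_point_def m i cross_def mult eq_0_iff av_pos_iff)
  next
    case 3
    thus ?thesis using p by (simp add: xy proj_point_def m i cross_def mult eq_0_iff av_pos_iff)
  next
    case 4
    thus ?thesis by (simp add: xy proj_point_def cross_def)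
  qed
qed

text \<open>The perturbation is smaller than the dominant coordinate of \<open>v\<close>, which
  therefore keeps its absolute value.\<close>

lemma vec_norm_ray_ge:
  assumes "av w * vec_norm b < vec_norm v"
  shows "vec_norm v \<le> vec_norm (ray v b w)"
proof -
  have small: "av (w * fst b) < vec_norm v" "av (w * snd b) < vec_norm v"
    using assms mult_left_mono[OF max.cobounded1, of "av w" "av (fst b)" "av (snd b)"]
      mult_left_mono[OF max.cobounded2, of "av w" "av (snd b)" "av (fst b)"] nonneg[of w]
    by (auto simp: mult vec_norm_def)
  show ?thesis
  proof (cases "av (fst v) \<le> av (snd v)")
    case True
    thus ?thesis using av_add_eq[of "w * snd b" "snd v"] small(2)
      by (simp add: vec_norm_def ray_def le_max_iff_disj)
  next
    case False
    thus ?thesis using av_add_eq[of "w * fst b" "fst v"] small(1)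
      by (simp add: vec_norm_def ray_def le_max_iff_disj)
  qed
qed

lemma chordal_ray_le:
  assumes "cross v b \<noteq> 0" "av w * vec_norm b < vec_norm v"
  shows "chordal av (proj_point (ray v b w)) (proj_point v) \<le> av w * (av (cross v b) / (vec_norm v)\<^sup>2)"
proof -
  have v: "v \<noteq> 0" using assms(1) by (auto simp: cross_def)
  have "chordal av (proj_point (ray v b w)) (proj_point v) =
      av w * av (cross v b) / (vec_norm (ray v b w) * vec_norm v)"
    using chordal_proj_point[OF ray_nonzero[OF assms(1), of w] v] cross_ray_ray[of v b w 0]
    by (simp add: mult)
  also have "\<dots> \<le> av w * av (cross v b) / (vec_norm v * vec_norm v)"
    using vec_norm_ray_ge[OF assms(2)] vec_norm_pos[OF v] nonneg
    by (intro divide_left_mono mult_right_mono mult_pos_pos mult_nonneg_nonneg) auto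
  finally show ?thesis by (simp add: power2_eq_square)
qed

lemma chordal_nonneg: "0 \<le> chordal av x y"
  by (cases x; cases y) (use nonneg in \<open>auto simp: max_def\<close>)

end

section \<open>The map between two affine charts\<close>

locale tame_rational_map = rational_map \<phi> P Q d + tame_av av d
  for \<phi> :: "'a::alg_closed_field poly fract" and P Q d and av :: "'a \<Rightarrow> real"
begin

text \<open>By Cramer's rule \<open>chart_num\<close> over \<open>chart_den\<close> is the map in
  the target coordinate that is 0 at \<open>lift v\<close> and infinity at
  \<open>b'\<close>.\<close>

definition chart_num :: "'a \<times> 'a \<Rightarrow> 'a \<times> 'a \<Rightarrow> 'a poly" where
  "chart_num v b = smult (fst (lift v)) (snd (lift_poly (line_pair v b))) -
                   smult (snd (lift v)) (fst (lift_poly (line_pair v b)))"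

definition chart_den :: "'a \<times> 'a \<Rightarrow> 'a \<times> 'a \<Rightarrow> 'a \<times> 'a \<Rightarrow> 'a poly" where
  "chart_den v b b' = smult (snd b') (fst (lift_poly (line_pair v b))) -
                      smult (fst b') (snd (lift_poly (line_pair v b)))"

lemma eval_lift_line: "eval_pair (lift_poly (line_pair v b)) z = lift (ray v b z)"
  by (simp add: eval_lift_poly eval_line_pair ray_def)

lemma poly_chart_num: "poly (chart_num v b) z = cross (lift v) (lift (ray v b z))"
  unfolding eval_lift_line[symmetric] by (simp add: chart_num_def cross_def eval_pair_def)

lemma poly_chart_den: "poly (chart_den v b b') z = cross (lift (ray v b z)) b'"
  unfolding eval_lift_line[symmetric] by (simp add: chart_den_def cross_def eval_pair_def algebra_simps)

text \<open>The pair is a linear transform of the lifted line, so the Wronskian only acquires a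
  determinant: in a genuine chart its roots are those of \<open>jac\<close>.\<close>

lemma wronskian_chart:
  "poly (wronskian (chart_num v b) (chart_den v b b')) z =
     cross (lift v) b' * jac (ray v b z) * cross v b"
proof -
  let ?A = "fst (lift_poly (line_pair v b))" and ?B = "snd (lift_poly (line_pair v b))"
  have "wronskian (chart_num v b) (chart_den v b b') = smult (- cross (lift v) b') (wronskian ?A ?B)"
    by (simp add: wronskian_def chart_num_def chart_den_def cross_def pderiv_diff pderiv_smult
          algebra_simps smult_diff_left smult_diff_right smult_add_right smult_add_left)
  thus ?thesis
    using wronskian_lift_poly[of "line_pair v b" z]
    by (simp add: wronskian_line_pair eval_line_pair ray_def)
qed

lemma pderiv_chart_num_0:
  assumes "cross (lift v) b' \<noteq> 0"
  shows "poly (pderiv (chart_num v b)) 0 = jac v * cross v b"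
proof -
  have "poly (chart_num v b) 0 = 0" by (simp add: poly_chart_num cross_def)
  hence "poly (pderiv (chart_num v b)) 0 * cross (lift v) b' = cross (lift v) b' * (jac v * cross v b)"
    using wronskian_chart[of v b b' 0] by (simp add: wronskian_def poly_chart_den mult.assoc)
  thus ?thesis using assms by simp
qed

lemma rat_eval_chart:
  assumes "cross v b \<noteq> 0" "cross (lift v) b' \<noteq> 0" "poly (chart_den v b b') z \<noteq> 0"
  shows "rat_eval \<phi> (proj_point (ray v b z)) =
           proj_point (ray (lift v) b' (poly (chart_num v b) z / poly (chart_den v b b') z))"
proof -
  let ?u = "lift (ray v b z)" and ?w = "poly (chart_num v b) z / poly (chart_den v b b') z"
  have nz: "?u \<noteq> 0" by (intro lift_nonzero ray_nonzero assms)
  have "cross ?u (ray (lift v) b' ?w) = - cross (lift v) ?u + ?w * cross ?u b'"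
    by (simp add: cross_def ray_def algebra_simps)
  also have "\<dots> = 0" using assms(3) by (simp add: poly_chart_num poly_chart_den)
  finally show ?thesis
    using nz ray_nonzero[OF assms(2)] ray_nonzero[OF assms(1)]
    by (simp add: rat_eval_proj_point proj_point_eq_iff)
qed

text \<open>Once the factor \<open>z\<close> is removed from the numerator, both polynomials are
  nonzero at \<open>0\<close> and have constant absolute value up to the nearest root.\<close>

lemma chart_expansion_local:
  assumes "cross v b \<noteq> 0" "cross (lift v) b' \<noteq> 0" "jac v \<noteq> 0"
  shows "\<exists>r>0. \<forall>z. av z < r \<longrightarrow>
    (\<exists>w. av w = av (jac v * cross v b / cross (lift v) b') * av z \<and>
         rat_eval \<phi> (proj_point (ray v b z)) = proj_point (ray (lift v) b' w))"
proof -
  have const: "\<exists>r>0. \<forall>z. av z < r \<longrightarrow> av (poly p z) = av (poly p 0)" if p0: "poly p 0 \<noteq> 0" for p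
  proof -
    have p: "p \<noteq> 0" using p0 by auto
    have "finite {\<alpha>. poly p \<alpha> = 0}" using p by (simp add: poly_roots_finite)
    from gap_above[OF this, of 0 1 0] obtain r where r: "r > 0"
      "\<And>\<alpha>. poly p \<alpha> = 0 \<Longrightarrow> \<not> (0 < av \<alpha> \<and> av \<alpha> < r)" by auto
    have root: "r \<le> av \<alpha>" if "poly p \<alpha> = 0" for \<alpha>
      using r(2)[OF that] that p0 av_pos_iff[of \<alpha>] by (cases "\<alpha> = 0") auto
    have "av (poly p z) = av (poly p 0)" if z: "av z < r" for z
    proof -
      have "av (poly p z) = gauss_norm p 0 (av (z - 0))"
        using root z by (intro av_poly_eq_gauss_norm) force
      thus ?thesis using gauss_norm_no_roots[OF p, of r "av z"] root z nonneg[of z] by simp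
    qed
    thus ?thesis using r(1) by blast
  qed
  have "poly (chart_num v b) 0 = 0" by (simp add: poly_chart_num cross_def)
  then obtain N where N: "chart_num v b = [:0, 1:] * N" unfolding poly_eq_0_iff_dvd by auto
  have N0: "poly N 0 = jac v * cross v b"
    using pderiv_chart_num_0[OF assms(2), of b] by (simp add: N pderiv_mult pderiv_pCons)
  hence "poly N 0 \<noteq> 0" using assms by simp
  from const[OF this] obtain r1 where r1: "r1 > 0" "\<And>z. av z < r1 \<Longrightarrow> av (poly N z) = av (poly N 0)"
    by blast
  have D0: "poly (chart_den v b b') 0 = cross (lift v) b'" by (simp add: poly_chart_den)
  hence "poly (chart_den v b b') 0 \<noteq> 0" using assms by simp
  from const[OF this] obtain r2 where r2: "r2 > 0"
    "\<And>z. av z < r2 \<Longrightarrow> av (poly (chart_den v b b') z) = av (cross (lift v) b')"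
    unfolding D0 by blast
  show ?thesis
  proof (intro exI[of _ "min r1 r2"] conjI allI impI)
    fix z assume z: "av z < min r1 r2"
    have "poly (chart_den v b b') z \<noteq> 0"
      using r2(2)[of z] z assms(2) by (metis eq_0_iff min_less_iff_conj)
    from rat_eval_chart[OF assms(1,2) this]
    show "\<exists>w. av w = av (jac v * cross v b / cross (lift v) b') * av z \<and>
         rat_eval \<phi> (proj_point (ray v b z)) = proj_point (ray (lift v) b' w)"
      using r1(2)[of z] r2(2)[of z] z N0
      by (intro exI[of _ "poly (chart_num v b) z / poly (chart_den v b b') z"])
         (simp add: N av_divide mult)
  qed (use r1 r2 in auto)
qed

lemma chart_expansion:
  assumes v: "cross v b \<noteq> 0" "cross (lift v) b' \<noteq> 0" "jac v \<noteq> 0" and b: "cross (lift v) (lift b) = 0"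
    and s: "s > 0"
    and nocrit: "\<And>c w. jac (ray v b c) = 0 \<Longrightarrow> w \<noteq> 0 \<Longrightarrow> av w < s \<Longrightarrow>
        rat_eval \<phi> (proj_point (ray v b c)) \<noteq> proj_point (ray (lift v) b' w)"
    and z: "av z * av (jac v * cross v b / cross (lift v) b') < s"
  shows "\<exists>w. av w = av (jac v * cross v b / cross (lift v) b') * av z \<and>
         rat_eval \<phi> (proj_point (ray v b z)) = proj_point (ray (lift v) b' w)"
proof -
  let ?N = "chart_num v b" and ?D = "chart_den v b b'"
  have v0: "v \<noteq> 0" and b0: "b \<noteq> 0" using v(1) by (auto simp: cross_def)
  have D0: "poly ?D 0 = cross (lift v) b'" by (simp add: poly_chart_den)
  have top: "degree (fst (lift_poly (line_pair v b))) \<le> d" "degree (snd (lift_poly (line_pair v b))) \<le> d"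
     "(coeff (fst (lift_poly (line_pair v b))) d, coeff (snd (lift_poly (line_pair v b))) d) = lift b"
    using lift_poly_iter_top[of "line_pair v b" v b 1] by simp_all
  have degs: "degree ?N \<le> d" "degree ?D \<le> d"
    unfolding chart_num_def chart_den_def using top
    by (auto intro!: degree_diff_le order_trans[OF degree_smult_le])
  have "coeff ?N d = cross (lift v) (lift b)"
    unfolding top(3)[symmetric] by (simp add: chart_num_def cross_def)
  hence topN: "coeff ?N d = 0" using b by simp
  \<comment> \<open>Otherwise \<open>lift b\<close> would be proportional both to
    \<open>lift v\<close> and to \<open>b'\<close>, hence zero.\<close>
  have topD: "coeff ?D d \<noteq> 0"
  proof -
    have "coeff ?D d = cross (lift b) b'"
      unfolding top(3)[symmetric] by (simp add: chart_den_def cross_def algebra_simps)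
    thus ?thesis using cross_eq_0_imp_eq_0[OF v(2) b] lift_nonzero[OF b0] by metis
  qed
  have "degree ?N \<noteq> d"
  proof
    assume "degree ?N = d"
    hence "?N = 0" using topN by (metis leading_coeff_0_iff)
    thus False using \<open>degree ?N = d\<close> d_ge_2 by simp
  qed
  moreover have "d \<le> degree ?D" using topD by (rule le_degree)
  ultimately have deg: "degree ?N < degree ?D" using degs by simp
  have cop: "poly ?N x \<noteq> 0 \<or> poly ?D x \<noteq> 0" for x
    using cross_eq_0_imp_eq_0[OF v(2), of "lift (ray v b x)"] lift_nonzero[OF ray_nonzero[OF v(1)]]
    by (metis poly_chart_num poly_chart_den)
  have "av (poly ?N z) = av (poly (pderiv ?N) 0) * av z \<and> av (poly ?D z) = av (poly ?D 0)"
  proof (rule proper_disc_expansion[OF cop deg degs(2) s])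
    show "poly ?N 0 = 0" by (simp add: poly_chart_num cross_def)
    show "poly (pderiv ?N) 0 \<noteq> 0" using v by (simp add: pderiv_chart_num_0[OF v(2)])
    show "\<not> av (poly ?N c) < s * av (poly ?D c)"
      if c: "poly (wronskian ?N ?D) c = 0" "poly ?N c \<noteq> 0" for c
    proof
      assume less: "av (poly ?N c) < s * av (poly ?D c)"
      have Dc: "poly ?D c \<noteq> 0" using less nonneg[of "poly ?N c"] by auto
      have "jac (ray v b c) = 0" using c(1) v by (simp add: wronskian_chart)
      from nocrit[OF this, of "poly ?N c / poly ?D c"] rat_eval_chart[OF v(1,2) Dc] show False
        using c(2) Dc less av_pos_iff[of "poly ?D c"] by (simp add: av_divide field_simps)
    qed
    show "av z * av (poly (pderiv ?N) 0) < s * av (poly ?D 0)"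
      using z v(2) av_pos_iff[of "cross (lift v) b'"]
      by (simp add: D0 pderiv_chart_num_0[OF v(2)] av_divide field_simps)
  qed
  hence N: "av (poly ?N z) = av (jac v * cross v b) * av z" and D: "av (poly ?D z) = av (cross (lift v) b')"
    by (simp_all add: pderiv_chart_num_0[OF v(2)] D0)
  have "poly ?D z \<noteq> 0" using D v(2) by (metis eq_0_iff)
  from rat_eval_chart[OF v(1,2) this] N D show ?thesis
    by (intro exI[of _ "poly ?N z / poly ?D z"]) (simp add: av_divide)
qed

end

section \<open>The basin of the cycle\<close>

locale attracting_cycle = tame_rational_map \<phi> P Q d av
  for \<phi> :: "'a::alg_closed_field poly fract" and P Q d and av :: "'a \<Rightarrow> real" +
  fixes v0 :: "'a \<times> 'a" and n :: nat
  assumes v0: "v0 \<noteq> 0" and n_pos: "n > 0" and period: "(lift ^^ n) v0 = v0"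
    and mult_pos: "0 < av (\<Prod>i<n. jac ((lift ^^ i) v0))"
    and mult_less: "av (\<Prod>i<n. jac ((lift ^^ i) v0)) < 1"
begin

definition \<mu> :: real where
  "\<mu> = av (\<Prod>i<n. jac ((lift ^^ i) v0))"

definition orbit_vec :: "nat \<Rightarrow> 'a \<times> 'a" where
  "orbit_vec k = (lift ^^ k) v0"

text \<open>\<open>dual k\<close> represents a second preimage of the next point of the cycle. In the coordinate that
  is \<open>0\<close> at \<open>orbit_vec k\<close> and \<open>\<infinity>\<close> at \<open>dual k\<close>, the map therefore sends \<open>\<infinity>\<close> to \<open>0\<close>, which
  gives the degree condition of the expansion lemma.\<close>

definition dual :: "nat \<Rightarrow> 'a \<times> 'a" where
  "dual k = (SOME b. cross (orbit_vec k) b \<noteq> 0 \<and> cross (lift (orbit_vec k)) (lift b) = 0)"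

definition pt :: "nat \<Rightarrow> 'a \<Rightarrow> 'a proj_line" where
  "pt k z = proj_point (ray (orbit_vec k) (dual k) z)"

text \<open>The absolute value of the derivative at 0 of the map from chart \<open>k\<close> to the
  next one. It depends on the scaling of the dual vectors; only the product over a full turn is
  intrinsic.\<close>

definition rate :: "nat \<Rightarrow> real" where
  "rate k = av (jac (orbit_vec k) * cross (orbit_vec k) (dual k) / cross (orbit_vec (Suc k)) (dual (Suc k)))"

definition total_rate :: "nat \<Rightarrow> real" where
  "total_rate k = (\<Prod>i<k. rate i)"

section \<open>Periodicity of the charts and of the dilation factors\<close>

lemma orbit_vec_Suc: "orbit_vec (Suc k) = lift (orbit_vec k)"
  by (simp add: orbit_vec_def)

lemma orbit_vec_add_period: "orbit_vec (k + n) = orbit_vec k"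
  by (simp add: orbit_vec_def funpow_add period)

lemma orbit_vec_mod: "orbit_vec (k mod n) = orbit_vec k"
proof -
  have "orbit_vec (r + m * n) = orbit_vec r" for r m
  proof (induction m)
    case (Suc m)
    have "r + Suc m * n = (r + m * n) + n" by simp
    thus ?case using Suc by (simp only: orbit_vec_add_period)
  qed simp
  from this[of "k mod n" "k div n"] show ?thesis by simp
qed

lemma orbit_vec_nonzero: "orbit_vec k \<noteq> 0"
  unfolding orbit_vec_def using v0 by (rule lift_iter_nonzero)

lemma jac_vec: "jac (orbit_vec k) \<noteq> 0"
proof -
  have "(\<Prod>i<n. jac (orbit_vec i)) \<noteq> 0" using mult_pos by (simp add: av_pos_iff orbit_vec_def)
  hence "jac (orbit_vec (k mod n)) \<noteq> 0" using n_pos by simp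
  thus ?thesis by (simp add: orbit_vec_mod)
qed

lemma dual: "cross (orbit_vec k) (dual k) \<noteq> 0" "cross (lift (orbit_vec k)) (lift (dual k)) = 0"
proof -
  have "cross (orbit_vec k) (dual k) \<noteq> 0 \<and> cross (lift (orbit_vec k)) (lift (dual k)) = 0"
    unfolding dual_def by (rule someI_ex) (rule exists_other_preimage[OF orbit_vec_nonzero jac_vec])
  thus "cross (orbit_vec k) (dual k) \<noteq> 0" "cross (lift (orbit_vec k)) (lift (dual k)) = 0" by blast+
qed

lemma dual_Suc: "cross (lift (orbit_vec k)) (dual (Suc k)) \<noteq> 0"
  using dual(1)[of "Suc k"] by (simp add: orbit_vec_Suc)

lemma dual_add_period: "dual (k + n) = dual k"
  by (simp add: dual_def orbit_vec_add_period)

lemma pt_add_period: "pt (k + n) = pt k"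
  by (simp add: pt_def orbit_vec_add_period dual_add_period fun_eq_iff)

lemma pt_mod: "pt (k mod n) = pt k"
  by (simp add: pt_def dual_def orbit_vec_mod fun_eq_iff)

lemma pt_inj: "pt k z = pt k w \<Longrightarrow> z = w"
  unfolding pt_def by (rule proj_point_ray_inj[OF dual(1)])

lemma pt_0: "pt k 0 = proj_point (orbit_vec k)"
  by (simp add: pt_def)

lemma rat_eval_iter_pt_0: "(rat_eval \<phi> ^^ k) (pt 0 0) = pt k 0"
  by (simp add: pt_0 rat_eval_iter_proj_point[OF orbit_vec_nonzero] orbit_vec_def[of k]) (simp add: orbit_vec_def)

lemma rate_add_period: "rate (k + n) = rate k"
  using orbit_vec_add_period[of "Suc k"] dual_add_period[of "Suc k"]
  by (simp add: rate_def orbit_vec_add_period dual_add_period)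

lemma rate_pos: "rate k > 0"
  using dual(1) jac_vec by (simp add: rate_def av_pos_iff)

lemma total_rate_pos: "total_rate k > 0"
  by (simp add: total_rate_def rate_pos prod_pos)

lemma total_rate_Suc: "total_rate (Suc k) = total_rate k * rate k"
  by (simp add: total_rate_def)

text \<open>The cross products telescope, and after \<open>n\<close> steps the vector returns
  together with its dual, which is chosen from the vector alone.\<close>

lemma total_rate_period: "total_rate n = \<mu>"
proof -
  have "total_rate k = av ((\<Prod>i<k. jac (orbit_vec i)) * cross (orbit_vec 0) (dual 0) / cross (orbit_vec k) (dual k))" for k
    by (induction k) (use dual(1) in \<open>simp_all add: total_rate_def rate_def mult_ac flip: mult\<close>)
  from this[of n] show ?thesis
    using dual(1)[of 0] orbit_vec_add_period[of 0] dual_add_period[of 0] by (simp add: \<mu>_def orbit_vec_def)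
qed

lemma total_rate_add_period: "total_rate (k + n) = \<mu> * total_rate k"
proof (induction k)
  case 0
  show ?case by (simp add: total_rate_period) (simp add: total_rate_def)
next
  case (Suc k)
  thus ?case by (simp add: total_rate_Suc rate_add_period)
qed

lemma total_rate_add_periods: "total_rate (k + n * m) = \<mu> ^ m * total_rate k"
proof (induction m)
  case (Suc m)
  have "k + n * Suc m = (k + n * m) + n" by simp
  thus ?case using Suc by (simp only: total_rate_add_period power_Suc mult.assoc)
qed simp

lemma \<mu>: "0 < \<mu>" "\<mu> < 1"
  using mult_pos mult_less by (simp_all add: \<mu>_def)

text \<open>Orbits shrink by \<open>total_rate k\<close> up to chart \<open>k\<close>, so the radius
  is scaled likewise. A minimum over one period suffices, since a further turn multiplies the radius
  by \<open>\<mu> < 1\<close>.\<close>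

lemma exists_basin_radius:
  "\<exists>t>0. \<forall>k z. av z < t * total_rate k \<longrightarrow>
     (\<exists>w. av w = rate k * av z \<and> rat_eval \<phi> (pt k z) = pt (Suc k) w)"
proof -
  define good where "good k r \<longleftrightarrow> (\<forall>z. av z < r \<longrightarrow>
     (\<exists>w. av w = rate k * av z \<and> rat_eval \<phi> (pt k z) = pt (Suc k) w))" for k r
  have good_mono: "good k r" if "good k r'" "r \<le> r'" for k r r'
    using that by (auto simp: good_def)
  have good_period: "good (k + n) r \<longleftrightarrow> good k r" for k r
    using pt_add_period[of "Suc k"] by (simp add: good_def rate_add_period pt_add_period)
  have "\<exists>r>0. good k r" for k
    using chart_expansion_local[OF dual(1) dual_Suc jac_vec, of k]
    by (simp add: good_def rate_def pt_def orbit_vec_Suc)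
  then obtain r where r: "\<And>k. r k > 0" "\<And>k. good k (r k)" by metis
  define t where "t = Min ((\<lambda>k. r k / total_rate k) ` {..<n})"
  have "t > 0" unfolding t_def using n_pos r(1) total_rate_pos by (subst Min_gr_iff) auto
  have "good k (t * total_rate k)" for k
  proof (induction k rule: less_induct)
    case (less k)
    show ?case
    proof (cases "k < n")
      case True
      have "t \<le> r k / total_rate k" unfolding t_def using True by (intro Min_le) auto
      hence "t * total_rate k \<le> r k" using total_rate_pos[of k] by (simp add: field_simps)
      thus ?thesis using r(2) good_mono by blast
    next
      case False
      define j where "j = k - n"
      have k: "k = j + n" "j < k" using False n_pos by (simp_all add: j_def)
      have "\<mu> * total_rate j \<le> total_rate j" using \<mu> total_rate_pos[of j] by simp
      hence "t * total_rate k \<le> t * total_rate j"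
        using \<open>t > 0\<close> by (simp add: k(1) total_rate_add_period)
      with less[OF k(2)] good_mono have "good j (t * total_rate k)" by blast
      thus ?thesis unfolding k(1) good_period .
    qed
  qed
  thus ?thesis using \<open>t > 0\<close> by (auto simp: good_def)
qed

definition basin_radius :: real where
  "basin_radius = (SOME t. t > 0 \<and> (\<forall>k z. av z < t * total_rate k \<longrightarrow>
     (\<exists>w. av w = rate k * av z \<and> rat_eval \<phi> (pt k z) = pt (Suc k) w)))"

lemma basin_radius_pos: "basin_radius > 0"
  and basin_step: "av z < basin_radius * total_rate k \<Longrightarrow>
     \<exists>w. av w = rate k * av z \<and> rat_eval \<phi> (pt k z) = pt (Suc k) w"
proof -
  have "basin_radius > 0 \<and> (\<forall>k z. av z < basin_radius * total_rate k \<longrightarrow>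
     (\<exists>w. av w = rate k * av z \<and> rat_eval \<phi> (pt k z) = pt (Suc k) w))"
    unfolding basin_radius_def by (rule someI_ex) (rule exists_basin_radius)
  thus "basin_radius > 0" "av z < basin_radius * total_rate k \<Longrightarrow>
     \<exists>w. av w = rate k * av z \<and> rat_eval \<phi> (pt k z) = pt (Suc k) w"
    by simp_all
qed

lemma basin_orbit:
  assumes "av z < basin_radius"
  shows "\<exists>w. av w = total_rate k * av z \<and> (rat_eval \<phi> ^^ k) (pt 0 z) = pt k w"
proof (induction k)
  case 0
  show ?case by (rule exI[of _ z]) (simp add: total_rate_def)
next
  case (Suc k)
  then obtain w where w: "av w = total_rate k * av z" "(rat_eval \<phi> ^^ k) (pt 0 z) = pt k w" by blast
  have "av w < basin_radius * total_rate k"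
    using assms total_rate_pos[of k] by (simp add: w(1) mult.commute)
  from basin_step[OF this] show ?case by (auto simp: w total_rate_Suc mult_ac)
qed

text \<open>The predicate \<open>enters x\<close> describes the strict basin by finitely many iterates, so that it is
  trivially stable under taking preimages.\<close>

definition enters :: "'a proj_line \<Rightarrow> bool" where
  "enters x \<longleftrightarrow> (\<exists>m z. (rat_eval \<phi> ^^ m) x = pt 0 z \<and> z \<noteq> 0 \<and> av z < basin_radius)"

section \<open>Orbits in the strict basin\<close>

lemma enters_preimage:
  assumes "enters (rat_eval \<phi> x)"
  shows "enters x"
proof -
  obtain m z where mz: "(rat_eval \<phi> ^^ m) (rat_eval \<phi> x) = pt 0 z" "z \<noteq> 0" "av z < basin_radius"
    using assms by (auto simp: enters_def)
  hence "(rat_eval \<phi> ^^ Suc m) x = pt 0 z" by (simp add: funpow_swap1)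
  thus ?thesis using mz unfolding enters_def by blast
qed

lemma enters_orbit:
  assumes "enters x"
  shows "\<exists>m z. z \<noteq> 0 \<and>
    (\<forall>k. \<exists>w. av w = total_rate k * av z \<and> (rat_eval \<phi> ^^ (k + m)) x = pt k w)"
proof -
  obtain m z where mz: "(rat_eval \<phi> ^^ m) x = pt 0 z" "z \<noteq> 0" "av z < basin_radius"
    using assms by (auto simp: enters_def)
  have "\<exists>w. av w = total_rate k * av z \<and> (rat_eval \<phi> ^^ (k + m)) x = pt k w" for k
    using basin_orbit[OF mz(3), of k] by (simp add: funpow_add mz(1))
  thus ?thesis using mz(2) by blast
qed

text \<open>After entry the coordinates are nonzero and shrink by \<open>\<mu>\<close> in every
  turn, whereas an orbit that hits the cycle repeats after \<open>n\<close> steps.\<close>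

lemma enters_not_periodic:
  assumes "enters x"
  shows "(rat_eval \<phi> ^^ l) x \<noteq> pt 0 0"
proof
  assume l: "(rat_eval \<phi> ^^ l) x = pt 0 0"
  obtain m z where z: "z \<noteq> 0"
    and orb: "\<And>k. \<exists>w. av w = total_rate k * av z \<and> (rat_eval \<phi> ^^ (k + m)) x = pt k w"
    using enters_orbit[OF assms] by auto
  have cyc: "(rat_eval \<phi> ^^ (j * n)) (pt 0 0) = pt 0 0" for j
    unfolding rat_eval_iter_pt_0 using pt_mod[of "j * n"] by simp
  have hit: "(rat_eval \<phi> ^^ (j * n + l)) x = pt 0 0" for j
    by (simp add: funpow_add l cyc)
  \<comment> \<open>Makes \<open>k + m\<close> a time after entry at which the orbit is at
    \<open>pt 0 0\<close>. That point need not be the centre of chart \<open>k\<close>, so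
    coordinates one turn apart are compared.\<close>
  define k where "k = l + m * n - m"
  have "m \<le> m * n" using n_pos by simp
  hence "k + m = m * n + l" unfolding k_def by linarith
  hence k: "k + m = m * n + l" "k + n + m = Suc m * n + l" by simp_all
  obtain w where w: "av w = total_rate k * av z" "(rat_eval \<phi> ^^ (k + m)) x = pt k w"
    using orb by blast
  obtain w' where w': "av w' = total_rate (k + n) * av z" "(rat_eval \<phi> ^^ (k + n + m)) x = pt (k + n) w'"
    using orb by blast
  have "pt k w' = pt k w"
    using w(2) w'(2) hit[of m] hit[of "Suc m"] unfolding k by (simp add: pt_add_period)
  hence "w' = w" by (rule pt_inj)
  hence "\<mu> * (total_rate k * av z) = total_rate k * av z" using w(1) w'(1) by (auto simp: total_rate_add_period)
  moreover have "total_rate k * av z > 0" using z total_rate_pos by (simp add: av_pos_iff)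
  ultimately show False using \<mu> by auto
qed

lemma enters_attracted:
  assumes "enters x"
  shows "attracted_to_cycle av \<phi> n (pt 0 0) x"
proof -
  obtain m z where orb: "\<And>k. \<exists>w. av w = total_rate k * av z \<and> (rat_eval \<phi> ^^ (k + m)) x = pt k w"
    using enters_orbit[OF assms] by auto
  \<comment> \<open>Shifts the time of entry to a multiple of \<open>n\<close>; from then on all
    multiples of \<open>n\<close> are seen in the fixed chart \<open>r\<close>.\<close>
  define k where "k = n * m - m"
  define r where "r = k mod n"
  have "m \<le> n * m" using n_pos by simp
  hence "k + m = n * m" unfolding k_def by linarith
  hence km: "(k + n * i) + m = n * (i + m)" for i by (simp add: add_mult_distrib2)
  have "\<exists>w. av w = \<mu> ^ i * (total_rate k * av z) \<and> (rat_eval \<phi> ^^ (n * (i + m))) x = pt r w" for i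
  proof -
    have "pt (k + n * i) = pt r" using pt_mod[of "k + n * i"] by (simp add: r_def)
    thus ?thesis using orb[of "k + n * i"] by (simp add: km total_rate_add_periods mult.assoc)
  qed
  then obtain w where w: "\<And>i. av (w i) = \<mu> ^ i * (total_rate k * av z)"
    "\<And>i. (rat_eval \<phi> ^^ (n * (i + m))) x = pt r (w i)" by metis
  let ?C = "av (cross (orbit_vec r) (dual r)) / (vec_norm (orbit_vec r))\<^sup>2"
  have w0: "(\<lambda>i. av (w i)) \<longlonglongrightarrow> 0"
    unfolding w(1) using \<mu> by (intro tendsto_mult_left_zero LIMSEQ_power_zero) simp
  have "(\<lambda>i. av (w i) * vec_norm (dual r)) \<longlonglongrightarrow> 0" using w0 by (rule tendsto_mult_left_zero)
  hence "eventually (\<lambda>i. av (w i) * vec_norm (dual r) < vec_norm (orbit_vec r)) sequentially"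
    by (rule order_tendstoD(2)) (rule vec_norm_pos[OF orbit_vec_nonzero])
  hence ev: "eventually (\<lambda>i. norm (chordal av (pt r (w i)) (pt r 0)) \<le> av (w i) * ?C) sequentially"
  proof eventually_elim
    case (elim i)
    show ?case using chordal_ray_le[OF dual(1) elim] chordal_nonneg by (simp add: pt_def)
  qed
  have "(\<lambda>i. av (w i) * ?C) \<longlonglongrightarrow> 0" using w0 by (rule tendsto_mult_left_zero)
  with ev have "(\<lambda>i. chordal av (pt r (w i)) (pt r 0)) \<longlonglongrightarrow> 0"
    by (rule Lim_null_comparison)
  hence "(\<lambda>i. chordal av ((rat_eval \<phi> ^^ (n * (i + m))) x) (pt r 0)) \<longlonglongrightarrow> 0" by (simp only: w(2))
  hence "(\<lambda>i. chordal av ((rat_eval \<phi> ^^ (n * i)) x) (pt r 0)) \<longlonglongrightarrow> 0" by (rule LIMSEQ_offset)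
  thus ?thesis
    unfolding attracted_to_cycle_def proj_tendsto_def rat_eval_iter_pt_0
    using n_pos by (intro exI[of _ r]) (simp add: r_def)
qed

lemma enters_strictly_attracted:
  assumes "enters x"
  shows "strictly_attracted_to_cycle av \<phi> n (pt 0 0) x"
  unfolding strictly_attracted_to_cycle_def
  using enters_attracted[OF assms] enters_not_periodic[OF assms] by blast

text \<open>A critical point mapped into the punctured disc would itself enter, so
  \<open>nocrit\<close> provides the hypothesis of \<open>chart_expansion\<close>; the dilation then
  maps \<open>z\<close> into the punctured disc.\<close>

lemma enters_pullback:
  assumes nocrit: "\<And>c. critical_point \<phi> c \<Longrightarrow> \<not> enters c" and s: "s > 0"
    and ent: "\<And>z. z \<noteq> 0 \<Longrightarrow> av z < s \<Longrightarrow> enters (pt (Suc k) z)"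
    and z: "z \<noteq> 0" "av z * rate k < s"
  shows "enters (pt k z)"
proof -
  have "\<exists>w. av w = rate k * av z \<and> rat_eval \<phi> (pt k z) = pt (Suc k) w"
    unfolding pt_def rate_def orbit_vec_Suc
  proof (rule chart_expansion[OF dual(1) dual_Suc jac_vec dual(2) s])
    show "av z * av (jac (orbit_vec k) * cross (orbit_vec k) (dual k) / cross (lift (orbit_vec k)) (dual (Suc k))) < s"
      using z(2) by (simp add: rate_def orbit_vec_Suc)
    show "rat_eval \<phi> (proj_point (ray (orbit_vec k) (dual k) c)) \<noteq> proj_point (ray (lift (orbit_vec k)) (dual (Suc k)) w)"
      if c: "jac (ray (orbit_vec k) (dual k) c) = 0" "w \<noteq> 0" "av w < s" for c w
    proof
      assume eq: "rat_eval \<phi> (proj_point (ray (orbit_vec k) (dual k) c)) = proj_point (ray (lift (orbit_vec k)) (dual (Suc k)) w)"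
      have "enters (rat_eval \<phi> (proj_point (ray (orbit_vec k) (dual k) c)))"
        unfolding eq using ent[OF c(2,3)] by (simp only: pt_def orbit_vec_Suc)
      hence "enters (proj_point (ray (orbit_vec k) (dual k) c))" by (rule enters_preimage)
      thus False using nocrit[OF critical_pointI[OF ray_nonzero[OF dual(1)] c(1)]] by simp
    qed
  qed
  then obtain w where w: "av w = rate k * av z" "rat_eval \<phi> (pt k z) = pt (Suc k) w" by blast
  have "w \<noteq> 0" using w(1) z(1) rate_pos[of k] by (auto simp: eq_0_iff)
  moreover have "av w < s" using w(1) z(2) by (simp add: mult.commute)
  ultimately have "enters (rat_eval \<phi> (pt k z))" unfolding w(2) by (rule ent)
  thus ?thesis by (rule enters_preimage)
qed

lemma exists_critical_enters: "\<exists>c. critical_point \<phi> c \<and> enters c"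
proof (rule ccontr)
  assume "\<nexists>c. critical_point \<phi> c \<and> enters c"
  hence nocrit: "\<And>c. critical_point \<phi> c \<Longrightarrow> \<not> enters c" by blast
  have pull: "\<forall>z. z \<noteq> 0 \<longrightarrow> av z * total_rate k < s \<longrightarrow> enters (pt 0 z)"
    if "s > 0" "\<forall>z. z \<noteq> 0 \<longrightarrow> av z < s \<longrightarrow> enters (pt k z)" for s k
    using that
  proof (induction k arbitrary: s)
    case 0
    thus ?case by (simp add: total_rate_def)
  next
    case (Suc k)
    have "\<forall>z. z \<noteq> 0 \<longrightarrow> av z < s / rate k \<longrightarrow> enters (pt k z)"
      using enters_pullback[OF nocrit Suc.prems(1)] Suc.prems(2) rate_pos[of k]
      by (simp add: pos_less_divide_eq)
    from Suc.IH[OF _ this] Suc.prems(1) rate_pos[of k]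
    show ?case by (simp add: total_rate_Suc pos_less_divide_eq mult_ac)
  qed
  have all: "\<forall>z. z \<noteq> 0 \<longrightarrow> av z < basin_radius / \<mu> ^ i \<longrightarrow> enters (pt 0 z)" for i
  proof (induction i)
    case 0
    have "(rat_eval \<phi> ^^ 0) (pt 0 z) = pt 0 z" for z by simp
    thus ?case unfolding enters_def by (metis div_by_1 power_0)
  next
    case (Suc i)
    \<comment> \<open>Chart \<open>n\<close> is chart \<open>0\<close> again, so pulling back over
      one turn divides the radius by \<open>\<mu>\<close>.\<close>
    have "\<forall>z. z \<noteq> 0 \<longrightarrow> av z < basin_radius / \<mu> ^ i \<longrightarrow> enters (pt n z)"
      using Suc pt_add_period[of 0] by simp
    from pull[OF _ this] show ?case
      using basin_radius_pos \<mu> by (simp add: total_rate_period field_simps)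
  qed
  have enters_pt: "enters (pt 0 z)" if "z \<noteq> 0" for z
  proof -
    have "(\<lambda>i. av z * \<mu> ^ i) \<longlonglongrightarrow> 0"
      using \<mu> by (intro tendsto_mult_right_zero LIMSEQ_power_zero) simp
    from order_tendstoD(2)[OF this basin_radius_pos]
    obtain i where "av z * \<mu> ^ i < basin_radius" by (auto simp: eventually_sequentially)
    thus ?thesis using all[of i] that \<mu> by (simp add: field_simps)
  qed
  let ?\<beta> = "proj_point (dual 0)"
  have dual_nz: "dual 0 \<noteq> 0" using dual(1)[of 0] by (auto simp: cross_def)
  have \<beta>: "rat_eval \<phi> ?\<beta> = pt 1 0"
    using dual(2)[of 0] lift_nonzero[OF dual_nz] lift_nonzero[OF orbit_vec_nonzero[of 0]]
    by (simp add: rat_eval_proj_point[OF dual_nz] pt_0 orbit_vec_Suc proj_point_eq_iff)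
       (simp add: cross_def mult.commute)
  have pt1: "(rat_eval \<phi> ^^ (n - 1)) (pt 1 0) = pt 0 0"
    using rat_eval_iter_pt_0[of n] rat_eval_iter_pt_0[of 1] n_pos pt_add_period[of 0]
    by (cases n) (simp_all add: funpow_swap1)
  \<comment> \<open>This point reaches \<open>pt 0 0\<close> after \<open>n + 1\<close> steps, so it
    cannot enter; it must be 0 or infinity in chart \<open>0\<close>.\<close>
  obtain u where u: "u \<noteq> 0" "rat_eval \<phi> (proj_point u) = ?\<beta>" using rat_eval_surj by blast
  obtain a b where ab: "u = (a * fst (orbit_vec 0) + b * fst (dual 0), a * snd (orbit_vec 0) + b * snd (dual 0))"
    using cross_basis[OF dual(1)] by blast
  show False
  proof (cases "a = 0 \<or> b = 0")
    case True
    \<comment> \<open>The centre and infinity of chart \<open>0\<close> have the same image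
      \<open>pt 1 0\<close>, so \<open>u\<close> maps there. This makes \<open>?\<beta>\<close> a
      fixed point equal to \<open>pt 0 0\<close>, although a chart has distinct centre and
      infinity.\<close>
    have "?\<beta> = pt 1 0"
    proof (cases "a = 0")
      case True
      hence "b \<noteq> 0" using ab u(1) by (auto simp: zero_prod_def)
      hence "proj_point u = ?\<beta>" using ab True proj_point_scale by simp
      thus ?thesis using u \<beta> by simp
    next
      case False
      hence "b = 0" using \<open>a = 0 \<or> b = 0\<close> by simp
      hence "proj_point u = pt 0 0" using ab False proj_point_scale by (simp add: pt_0)
      thus ?thesis using u rat_eval_iter_pt_0[of 1] by simp
    qed
    hence "(rat_eval \<phi> ^^ j) ?\<beta> = ?\<beta>" for j using \<beta> by (induction j) simp_all
    hence "pt 0 0 = ?\<beta>" using pt1 \<open>?\<beta> = pt 1 0\<close> by metis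
    thus False using dual(1)[of 0] orbit_vec_nonzero dual_nz by (simp add: pt_0 proj_point_eq_iff)
  next
    case False
    have "u = (a * fst (ray (orbit_vec 0) (dual 0) (b / a)), a * snd (ray (orbit_vec 0) (dual 0) (b / a)))"
      using False by (simp add: ab ray_def field_simps)
    hence "proj_point u = pt 0 (b / a)" unfolding pt_def using False proj_point_scale by metis
    hence "enters (proj_point u)" using False enters_pt by simp
    moreover have "(rat_eval \<phi> ^^ (n - 1 + 2)) (proj_point u) = pt 0 0"
      unfolding funpow_add using u \<beta> pt1 by (simp add: numeral_2_eq_2)
    ultimately show False using enters_not_periodic by blast
  qed
qed

end

theorem theorem1p5:
  fixes av :: "'a::alg_closed_field \<Rightarrow> real"
    and \<phi> :: "'a poly fract"
    and d n p :: nat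
    and \<gamma> :: "'a proj_line"
  assumes "nonarch_absolute_value av"
    and "nontrivial_av av"
    and "complete_av av"
    and "residue_char av = p"
    and "rat_degree \<phi> = d"
    and "d \<ge> 2"
    and "CHAR('a) = 0 \<or> CHAR('a) > d"
    and "p = 0 \<or> d < p"
    and "periodic_point \<phi> n \<gamma>"
    and "0 < av (multiplier \<phi> n \<gamma>)"
    and "av (multiplier \<phi> n \<gamma>) < 1"
  shows "\<exists>c. critical_point \<phi> c \<and> strictly_attracted_to_cycle av \<phi> n \<gamma> c"
proof -
  interpret nonarch_absolute_value av by fact
  obtain P Q where PQ: "rat_quot \<phi> = (P, Q)" by fastforce
  interpret tame_rational_map \<phi> P Q d av
  proof unfold_locales
    show "d = max (degree P) (degree Q)" using assms(5) PQ by (simp add: rat_degree_def)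
    show "av (of_nat m) = 1" if "0 < m" "m \<le> d" for m
      using av_of_nat_eq_1[of d m] that assms by auto
  qed (use PQ assms in auto)
  have n: "n > 0" "(rat_eval \<phi> ^^ n) \<gamma> = \<gamma>" using assms(9) by (simp_all add: periodic_point_def)
  obtain v where v: "v \<noteq> 0" "proj_point v = \<gamma>" using proj_point_surj by blast
  have "cross v ((lift ^^ n) v) = 0"
    using n(2) v rat_eval_iter_proj_point[OF v(1), of n] proj_point_eq_iff[OF v(1) lift_iter_nonzero[OF v(1)], of n]
    by simp
  moreover obtain w where w: "cross v w \<noteq> 0" using exists_cross_nonzero[OF v(1)] by blast
  obtain a b where ab: "(lift ^^ n) v = (a * fst v + b * fst w, a * snd v + b * snd w)"
    using cross_basis[OF w] by blast
  ultimately have "b * cross v w = 0" by (simp add: ab cross_def algebra_simps)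
  hence lv: "(lift ^^ n) v = (a * fst v, a * snd v)" using ab w by simp
  have a: "a \<noteq> 0" using lv lift_iter_nonzero[OF v(1), of n] by (auto simp: zero_prod_def)
  have dn: "d ^ n > 1" using d_ge_2 n(1) by (intro one_less_power) simp_all
  \<comment> \<open>By homogeneity of degree \<open>d ^ n\<close>, scaling \<open>v\<close> by
    \<open>c\<close> multiplies the factor \<open>a\<close> by \<open>c ^ (d ^ n - 1)\<close>; this
    choice makes the vector itself periodic.\<close>
  then obtain c where c: "c ^ (d ^ n - 1) = inverse a" using nth_root_exists[of "d ^ n - 1"] by auto
  have "c \<noteq> 0" using c a dn by (auto simp: power_0_left)
  define v0 where "v0 = (c * fst v, c * snd v)"
  have "c ^ (d ^ n) = c * inverse a" using c dn by (metis power_eq_if not_one_less_zero)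
  hence per: "(lift ^^ n) v0 = v0"
    unfolding v0_def lift_iter_scale lv using a by simp
  have rep: "v0 \<noteq> 0" "proj_point v0 = \<gamma>"
  proof -
    show "v0 \<noteq> 0" using v(1) \<open>c \<noteq> 0\<close> by (cases v) (simp add: v0_def zero_prod_def)
    show "proj_point v0 = \<gamma>" unfolding v0_def proj_point_scale[OF \<open>c \<noteq> 0\<close>] by (rule v(2))
  qed
  interpret attracting_cycle \<phi> P Q d av v0 n
    using rep n(1) per assms(10,11) multiplier_eq[OF rep(1) per] by unfold_locales simp_all
  have "pt 0 0 = \<gamma>" by (simp add: pt_0 orbit_vec_def rep)
  thus ?thesis using exists_critical_enters enters_strictly_attracted by metis
qed

end
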